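(* Let $\kappa,\lambda$ be cardinals such that $\omega_1\leq\kappa<\lambda$ and $2^\kappa=2^\lambda$. Then there is a $\kappa^+$-irresolvable regular space $X$ such that $|X|=\Delta(X)=\lambda$ and all continuous real-valued functions on $X$ are constant.
   Context: $\kappa^+$ is the successor cardinal of $\kappa$. The dispersion character $\Delta(X)$ of a space $X$ is the smallest cardinality of a nonempty open subset of $X$. For a cardinal $\nu$, a space $X$ is $\nu$-resolvable if it contains $\nu$ many pairwise disjoint dense subsets; $X$ is $\nu$-irresolvable if $\nu\leq\Delta(X)$ and $X$ is not $\nu$-resolvable. Regular spaces are understood to be $T_1$ (i.e. regular means $T_3$). *)

theory Defs
  imports "HOL-Analysis.Analysis"
begin

unbundle cardinal_syntax

text \<open>
  Cardinals are well-orders satisfying \<^const>\<open>Card_order\<close>, compared across types by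
  \<open>\<le>o\<close>, \<open><o\<close> and \<open>=o\<close>; a cardinal-valued notion is thus determined up to \<open>=o\<close> only.
\<close>

definition dispersion_character :: "'a topology \<Rightarrow> 'a rel" where
  "dispersion_character X =
     (SOME d. (\<exists>U. openin X U \<and> U \<noteq> {} \<and> d = |U| ) \<and>
              (\<forall>V. openin X V \<and> V \<noteq> {} \<longrightarrow> d \<le>o |V| ))"

text \<open>
  A set of dense sets is the same as an injectively indexed family here: pairwise disjoint
  dense subsets of a nonempty space are nonempty, hence distinct.
\<close>

definition resolvable_space :: "'n rel \<Rightarrow> 'a topology \<Rightarrow> bool" where
  "resolvable_space \<nu> X \<longleftrightarrow>
     (\<exists>\<D>. |\<D>| =o \<nu> \<and> pairwise disjnt \<D> \<and>
          (\<forall>D\<in>\<D>. D \<subseteq> topspace X \<and> X closure_of D = topspace X))"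

definition irresolvable_space :: "'n rel \<Rightarrow> 'a topology \<Rightarrow> bool" where
  "irresolvable_space \<nu> X \<longleftrightarrow>
     \<nu> \<le>o dispersion_character X \<and> \<not> resolvable_space \<nu> X"

text \<open>The minimum exists for every nonempty space.\<close>

lemma dispersion_character_spec:
  assumes "topspace X \<noteq> {}"
  shows "(\<exists>U. openin X U \<and> U \<noteq> {} \<and> dispersion_character X = |U| ) \<and>
         (\<forall>V. openin X V \<and> V \<noteq> {} \<longrightarrow> dispersion_character X \<le>o |V| )"
proof -
  let ?R = "{ |U| | U. openin X U \<and> U \<noteq> {} }"
  have "?R \<noteq> {}"
    using assms by blast
  moreover have "\<forall>r\<in>?R. Card_order r"
    using card_of_Card_order by blast
  ultimately have "\<exists>d\<in>?R. \<forall>r\<in>?R. d \<le>o r"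
    by (rule exists_minim_Card_order)
  then obtain d where "d \<in> ?R" and le: "\<forall>r\<in>?R. d \<le>o r"
    by (rule bexE)
  then obtain U where U: "openin X U" "U \<noteq> {}" "d = |U|"
    by (elim CollectE exE conjE)
  have "d \<le>o |V|" if "openin X V \<and> V \<noteq> {}" for V
    by (rule bspec[OF le]) (intro CollectI exI[of _ V] conjI refl conjunct1[OF that] conjunct2[OF that])
  with U have "(\<exists>U. openin X U \<and> U \<noteq> {} \<and> d = |U| ) \<and>
      (\<forall>V. openin X V \<and> V \<noteq> {} \<longrightarrow> d \<le>o |V| )"
    by (intro conjI allI impI exI[of _ U])
  then have "\<exists>d. (\<exists>U. openin X U \<and> U \<noteq> {} \<and> d = |U| ) \<and>
      (\<forall>V. openin X V \<and> V \<noteq> {} \<longrightarrow> d \<le>o |V| )"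
    by (rule exI[of _ d])
  then show ?thesis
    unfolding dispersion_character_def by (rule someI_ex)
qed

lemma dispersion_character_unique:
  assumes "openin X U" "U \<noteq> {}" "\<And>V. openin X V \<Longrightarrow> V \<noteq> {} \<Longrightarrow> |U| \<le>o |V|"
  shows "dispersion_character X =o |U|"
proof -
  have ne: "topspace X \<noteq> {}"
    using assms(1,2) openin_subset by fastforce
  from dispersion_character_spec[OF ne] obtain W where W:
    "openin X W" "W \<noteq> {}" "dispersion_character X = |W|"
    and le: "\<forall>V. openin X V \<and> V \<noteq> {} \<longrightarrow> dispersion_character X \<le>o |V|"
    by blast
  have "dispersion_character X \<le>o |U|"
    using le assms(1,2) by blast
  moreover have "|U| \<le>o dispersion_character X"
    unfolding W(3) using assms(3)[OF W(1,2)] .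
  ultimately show ?thesis
    by (simp add: ordIso_iff_ordLeq)
qed

end

theory Submission
  imports Defs
begin

text \<open>
  A regular \<open>T\<^sub>1\<close> space \<open>Z\<close> with only constant real-valued maps and \<open>2 \<le> |Z| \<le> \<kappa>\<close> exists because
  \<open>\<kappa>\<close> is uncountable. Fix a set \<open>M\<close> of size \<open>\<mu>\<close> and take, by Zorn's lemma, a maximal family \<open>\<Phi>\<close> of
  functions \<open>M \<rightarrow> Z\<close> such that finitely many conditions \<open>\<phi> m \<in> B \<phi>\<close> with nonempty open sets \<open>B \<phi>\<close>
  can always be met; then evaluation maps \<open>M\<close> onto a dense subset of \<open>Z\<^sup>\<Phi>\<close>. Maximality forbids \<open>|Z|\<close>
  disjoint dense subsets of it, since a function with a different value on each of them could be
  added to \<open>\<Phi>\<close>. As \<open>|\<Phi>| \<le> 2\<^sup>\<mu> = 2\<^sup>\<kappa>\<close>, the index set \<open>\<Phi>\<close> embeds into the power set of \<open>\<kappa>\<close>, and the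
  \<open>\<kappa>\<close> many step functions on it with values in \<open>Z\<close> are dense in \<open>Z\<^sup>\<Phi>\<close>. Changing one value of a step
  function is a continuous image of \<open>Z\<close>, so real-valued maps are constant on step functions, and
  hence on the union \<open>X\<close> of the two dense sets. Among \<open>\<kappa>\<^sup>+\<close> disjoint dense subsets of \<open>X\<close> all but
  \<open>\<kappa>\<close> many avoid the step functions, which is impossible.
\<close>

section \<open>A regular space with two points that real-valued maps cannot separate\<close>

text \<open>
  The ladder has levels indexed by the integers. Points \<open>Ed n a b\<close> are isolated and join \<open>Vx n a\<close> to
  \<open>Vx (n + 1) b\<close>; a neighbourhood of a vertex contains all but finitely many of its edges, and
  neighbourhoods of \<open>Hi\<close> and \<open>Lo\<close> contain all sufficiently high resp. low levels. A real-valued map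
  agrees with its value at a vertex on all but countably many edges there, so for uncountable \<open>W\<close>
  a closed condition true infinitely often on one level is so on all levels.
\<close>

datatype 'w ladder = Vx int 'w | Ed int 'w 'w | Hi | Lo

definition ladder_open :: "'w set \<Rightarrow> 'w ladder set \<Rightarrow> bool" where
  "ladder_open W U \<longleftrightarrow> U \<subseteq> {x. set_ladder x \<subseteq> W} \<and>
     (\<forall>n a. Vx n a \<in> U \<longrightarrow> finite {b \<in> W. Ed n a b \<notin> U} \<and> finite {b \<in> W. Ed (n - 1) b a \<notin> U}) \<and>
     (Hi \<in> U \<longrightarrow> (\<exists>n. \<forall>m\<ge>n. \<forall>a\<in>W. Vx m a \<in> U \<and> (\<forall>b\<in>W. Ed m a b \<in> U))) \<and>
     (Lo \<in> U \<longrightarrow> (\<exists>n. \<forall>m\<le>n. \<forall>a\<in>W. Vx m a \<in> U \<and> (\<forall>b\<in>W. Ed m a b \<in> U)))"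

definition ladder_space :: "'w set \<Rightarrow> 'w ladder topology" where
  "ladder_space W = topology (ladder_open W)"

lemma ladder_open_subset: "ladder_open W U \<Longrightarrow> U \<subseteq> {x. set_ladder x \<subseteq> W}"
  unfolding ladder_open_def by simp

lemma ladder_open_Vx:
  assumes "ladder_open W U" "Vx n a \<in> U"
  shows "finite {b \<in> W. Ed n a b \<notin> U}" "finite {b \<in> W. Ed (n - 1) b a \<notin> U}"
  using assms unfolding ladder_open_def by auto

lemma ladder_open_Hi:
  assumes "ladder_open W U" "Hi \<in> U"
  shows "\<exists>n. \<forall>m\<ge>n. \<forall>a\<in>W. Vx m a \<in> U \<and> (\<forall>b\<in>W. Ed m a b \<in> U)"
  using assms unfolding ladder_open_def by simp

lemma ladder_open_Lo:
  assumes "ladder_open W U" "Lo \<in> U"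
  shows "\<exists>n. \<forall>m\<le>n. \<forall>a\<in>W. Vx m a \<in> U \<and> (\<forall>b\<in>W. Ed m a b \<in> U)"
  using assms unfolding ladder_open_def by simp

lemma istopology_ladder_open: "istopology (ladder_open W)"
  unfolding istopology_def
proof (intro conjI allI impI)
  fix S T assume S: "ladder_open W S" and T: "ladder_open W T"
  have fin: "finite {b \<in> W. P b \<notin> S \<inter> T}" if "finite {b \<in> W. P b \<notin> S}" "finite {b \<in> W. P b \<notin> T}"
    for P :: "'a \<Rightarrow> 'a ladder"
  proof -
    have "{b \<in> W. P b \<notin> S \<inter> T} = {b \<in> W. P b \<notin> S} \<union> {b \<in> W. P b \<notin> T}" by blast
    then show ?thesis using that by simp
  qed
  have hi: "\<exists>n. \<forall>m\<ge>n. \<forall>a\<in>W. Vx m a \<in> S \<inter> T \<and> (\<forall>b\<in>W. Ed m a b \<in> S \<inter> T)" if ST: "Hi \<in> S \<inter> T"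
  proof -
    obtain n1 where n1: "\<forall>m\<ge>n1. \<forall>a\<in>W. Vx m a \<in> S \<and> (\<forall>b\<in>W. Ed m a b \<in> S)"
      using ladder_open_Hi[OF S IntD1[OF ST]] ..
    obtain n2 where n2: "\<forall>m\<ge>n2. \<forall>a\<in>W. Vx m a \<in> T \<and> (\<forall>b\<in>W. Ed m a b \<in> T)"
      using ladder_open_Hi[OF T IntD2[OF ST]] ..
    show ?thesis by (rule exI[of _ "max n1 n2"]) (simp add: n1 n2)
  qed
  have lo: "\<exists>n. \<forall>m\<le>n. \<forall>a\<in>W. Vx m a \<in> S \<inter> T \<and> (\<forall>b\<in>W. Ed m a b \<in> S \<inter> T)" if ST: "Lo \<in> S \<inter> T"
  proof -
    obtain n1 where n1: "\<forall>m\<le>n1. \<forall>a\<in>W. Vx m a \<in> S \<and> (\<forall>b\<in>W. Ed m a b \<in> S)"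
      using ladder_open_Lo[OF S IntD1[OF ST]] ..
    obtain n2 where n2: "\<forall>m\<le>n2. \<forall>a\<in>W. Vx m a \<in> T \<and> (\<forall>b\<in>W. Ed m a b \<in> T)"
      using ladder_open_Lo[OF T IntD2[OF ST]] ..
    show ?thesis by (rule exI[of _ "min n1 n2"]) (simp add: n1 n2)
  qed
  show "ladder_open W (S \<inter> T)"
    unfolding ladder_open_def
    using S T by (intro conjI allI impI fin hi lo) (auto simp: ladder_open_def)
next
  fix \<K> :: "'a ladder set set" assume K: "\<forall>K\<in>\<K>. ladder_open W K"
  have fin: "finite {b \<in> W. P b \<notin> \<Union>\<K>}" if "finite {b \<in> W. P b \<notin> K}" "K \<in> \<K>"
    for P :: "'a \<Rightarrow> 'a ladder" and K
    by (rule finite_subset[OF _ that(1)]) (use that(2) in blast)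
  show "ladder_open W (\<Union>\<K>)"
    unfolding ladder_open_def
  proof (intro conjI allI impI)
    show "\<Union>\<K> \<subseteq> {x. set_ladder x \<subseteq> W}" using K ladder_open_subset by blast
  next
    fix n a assume "Vx n a \<in> \<Union>\<K>"
    then obtain K' where K': "K' \<in> \<K>" "Vx n a \<in> K'" by blast
    with K have "ladder_open W K'" by blast
    then show "finite {b \<in> W. Ed n a b \<notin> \<Union>\<K>}" "finite {b \<in> W. Ed (n - 1) b a \<notin> \<Union>\<K>}"
      using fin[OF _ K'(1)] ladder_open_Vx[OF _ K'(2)] by auto
  next
    assume "Hi \<in> \<Union>\<K>"
    then obtain K' where K': "K' \<in> \<K>" "Hi \<in> K'" by blast
    with K have "ladder_open W K'" by blast
    from ladder_open_Hi[OF this K'(2)] obtain n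
      where n: "\<forall>m\<ge>n. \<forall>a\<in>W. Vx m a \<in> K' \<and> (\<forall>b\<in>W. Ed m a b \<in> K')" ..
    show "\<exists>n. \<forall>m\<ge>n. \<forall>a\<in>W. Vx m a \<in> \<Union>\<K> \<and> (\<forall>b\<in>W. Ed m a b \<in> \<Union>\<K>)"
      by (rule exI[of _ n]) (use n K'(1) in blast)
  next
    assume "Lo \<in> \<Union>\<K>"
    then obtain K' where K': "K' \<in> \<K>" "Lo \<in> K'" by blast
    with K have "ladder_open W K'" by blast
    from ladder_open_Lo[OF this K'(2)] obtain n
      where n: "\<forall>m\<le>n. \<forall>a\<in>W. Vx m a \<in> K' \<and> (\<forall>b\<in>W. Ed m a b \<in> K')" ..
    show "\<exists>n. \<forall>m\<le>n. \<forall>a\<in>W. Vx m a \<in> \<Union>\<K> \<and> (\<forall>b\<in>W. Ed m a b \<in> \<Union>\<K>)"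
      by (rule exI[of _ n]) (use n K'(1) in blast)
  qed
qed

lemma openin_ladder_space: "openin (ladder_space W) U \<longleftrightarrow> ladder_open W U"
  unfolding ladder_space_def by (simp only: topology_inverse'[OF istopology_ladder_open])

lemma topspace_ladder_space: "topspace (ladder_space W) = {x. set_ladder x \<subseteq> W}"
proof
  have "ladder_open W {x. set_ladder x \<subseteq> W}"
    unfolding ladder_open_def by (auto intro: exI[of _ 0])
  then show "{x. set_ladder x \<subseteq> W} \<subseteq> topspace (ladder_space W)"
    unfolding openin_ladder_space[symmetric] by (rule openin_subset)
  show "topspace (ladder_space W) \<subseteq> {x. set_ladder x \<subseteq> W}"
    using openin_topspace[of "ladder_space W"] ladder_open_subset by (metis openin_ladder_space)
qed

lemma closedin_ladder_space:
  "closedin (ladder_space W) C \<longleftrightarrow> C \<subseteq> {x. set_ladder x \<subseteq> W} \<and> ladder_open W ({x. set_ladder x \<subseteq> W} - C)"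
  by (simp add: closedin_def openin_ladder_space topspace_ladder_space)

section \<open>Separation properties of the ladder\<close>

lemma finite_subset_singleton: "A \<subseteq> {a} \<Longrightarrow> finite A"
  by (rule finite_subset) auto

lemma t1_space_ladder: "t1_space (ladder_space W)"
proof -
  have "ladder_open W ({x. set_ladder x \<subseteq> W} - {p})" for p
    unfolding ladder_open_def
  proof (intro conjI allI impI)
    fix n a assume "Vx n a \<in> {x. set_ladder x \<subseteq> W} - {p}"
    then have a: "a \<in> W" by simp
    show "finite {b \<in> W. Ed n a b \<notin> {x. set_ladder x \<subseteq> W} - {p}}"
    proof (rule finite_subset_singleton)
      \<comment> \<open>At most one edge going up from this vertex equals \<open>p\<close>. If none
        does, the left side is empty and the unspecified value of \<open>THE\<close> is
        harmless.\<close>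
      show "{b \<in> W. Ed n a b \<notin> {x. set_ladder x \<subseteq> W} - {p}} \<subseteq> {THE b. Ed n a b = p}" using a by auto
    qed
    show "finite {b \<in> W. Ed (n - 1) b a \<notin> {x. set_ladder x \<subseteq> W} - {p}}"
    proof (rule finite_subset_singleton)
      show "{b \<in> W. Ed (n - 1) b a \<notin> {x. set_ladder x \<subseteq> W} - {p}} \<subseteq> {THE b. Ed (n-1) b a = p}" using a by auto
    qed
  next
    \<comment> \<open>\<open>k\<close> is the level of \<open>p\<close>; for the two ends the
      condition is vacuous and any integer serves.\<close>
    obtain k where k: "\<And>m a b. p = Vx m a \<or> p = Ed m a b \<Longrightarrow> m = k"
      by (cases p) auto
    show "\<exists>n. \<forall>m\<ge>n. \<forall>a\<in>W. Vx m a \<in> {x. set_ladder x \<subseteq> W} - {p} \<and>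
            (\<forall>b\<in>W. Ed m a b \<in> {x. set_ladder x \<subseteq> W} - {p})"
      by (rule exI[of _ "k + 1"]) (use k in force)
    show "\<exists>n. \<forall>m\<le>n. \<forall>a\<in>W. Vx m a \<in> {x. set_ladder x \<subseteq> W} - {p} \<and>
            (\<forall>b\<in>W. Ed m a b \<in> {x. set_ladder x \<subseteq> W} - {p})"
      by (rule exI[of _ "k - 1"]) (use k in force)
  qed auto
  then show ?thesis
    unfolding t1_space_closedin_singleton closedin_ladder_space topspace_ladder_space by auto
qed

text \<open>The part of a vertex's star inside \<open>U\<close> is clopen, and so is a single edge
  point. At the two ends, the closed neighbourhood exceeds the open one by one level of
  vertices.\<close>

lemma regular_space_ladder: "regular_space (ladder_space W)"
proof -
  let ?T = "{x. set_ladder x \<subseteq> W}"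
  have "\<exists>V C. ladder_open W V \<and> C \<subseteq> ?T \<and> ladder_open W (?T - C) \<and> x \<in> V \<and> V \<subseteq> C \<and> C \<subseteq> U"
    if U: "ladder_open W U" and x: "x \<in> U" for U x
  proof (cases x)
    case (Vx n a)
    have a: "a \<in> W" using U x Vx unfolding ladder_open_def by force
    define V where "V = {Vx n a} \<union> ({Ed n a b | b. b \<in> W} \<union> {Ed (n-1) b a | b. b \<in> W}) \<inter> U"
    have V1: "ladder_open W V"
    proof -
      have "finite {b \<in> W. Ed n a b \<notin> U}" "finite {b \<in> W. Ed (n-1) b a \<notin> U}"
        using ladder_open_Vx[OF U, of n a] x Vx by simp_all
      moreover have "{b \<in> W. Ed n a b \<notin> V} = {b \<in> W. Ed n a b \<notin> U}"
        "{b \<in> W. Ed (n-1) b a \<notin> V} = {b \<in> W. Ed (n-1) b a \<notin> U}"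
        unfolding V_def by auto
      ultimately have "finite {b \<in> W. Ed n a b \<notin> V}" "finite {b \<in> W. Ed (n-1) b a \<notin> V}" by simp_all
      moreover have "V \<subseteq> ?T" unfolding V_def using a by auto
      moreover have "Hi \<notin> V" "Lo \<notin> V" "\<And>m c. Vx m c \<in> V \<Longrightarrow> m = n \<and> c = a" by (auto simp: V_def)
      ultimately show ?thesis unfolding ladder_open_def by blast
    qed
    \<comment> \<open>Any other vertex has at most one edge in \<open>V\<close>, the one joining it
      to \<open>Vx n a\<close>. The edges in \<open>V\<close> lie on levels \<open>n - 1\<close> and
      \<open>n\<close>, whence the bounds \<open>n + 1\<close> and \<open>n - 2\<close>.\<close>
    have V2: "ladder_open W (?T - V)"
      unfolding ladder_open_def
    proof (intro conjI allI impI)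
      fix m c assume mc: "Vx m c \<in> ?T - V"
      then have "m \<noteq> n \<or> c \<noteq> a" unfolding V_def by auto
      then show "finite {b \<in> W. Ed m c b \<notin> ?T - V}" "finite {b \<in> W. Ed (m-1) b c \<notin> ?T - V}"
        using mc by (auto intro!: finite_subset_singleton[of _ a] simp: V_def)
    next
      show "\<exists>k. \<forall>m\<ge>k. \<forall>a\<in>W. Vx m a \<in> ?T - V \<and> (\<forall>b\<in>W. Ed m a b \<in> ?T - V)"
        by (rule exI[of _ "n+1"]) (auto simp: V_def)
      show "\<exists>k. \<forall>m\<le>k. \<forall>a\<in>W. Vx m a \<in> ?T - V \<and> (\<forall>b\<in>W. Ed m a b \<in> ?T - V)"
        by (rule exI[of _ "n-2"]) (auto simp: V_def)
    qed auto
    show ?thesis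
      by (intro exI[of _ V] conjI V1 V2) (use U x Vx a in \<open>auto simp: V_def\<close>)
  next
    case (Ed n a b)
    have V: "ladder_open W {x}" using U x Ed unfolding ladder_open_def by auto
    have "closedin (ladder_space W) {x}"
      using t1_space_ladder[of W] U x by (auto simp: t1_space_closedin_singleton topspace_ladder_space ladder_open_def)
    then show ?thesis
      by (intro exI[of _ "{x}"]) (use V x closedin_ladder_space in auto)
  next
    case Hi
    obtain n where n: "\<forall>m\<ge>n. \<forall>a\<in>W. Vx m a \<in> U \<and> (\<forall>b\<in>W. Ed m a b \<in> U)"
      using ladder_open_Hi[OF U] x Hi by auto
    \<comment> \<open>Vertices on level \<open>n\<close> have their downward edges on level
      \<open>n - 1\<close>, outside \<open>V\<close>, so those of \<open>V\<close> start at
      \<open>n + 1\<close>. Their upward edges lie in \<open>C\<close>, so \<open>C\<close> includes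
      them to have an open complement.\<close>
    define V where "V = {Hi} \<union> {Vx m a | m a. m \<ge> n + 1 \<and> a \<in> W} \<union> {Ed m a b | m a b. m \<ge> n \<and> a \<in> W \<and> b \<in> W}"
    define C where "C = {Hi} \<union> {Vx m a | m a. m \<ge> n \<and> a \<in> W} \<union> {Ed m a b | m a b. m \<ge> n \<and> a \<in> W \<and> b \<in> W}"
    have "ladder_open W V"
      unfolding ladder_open_def by (auto simp: V_def intro!: exI[of _ "n+1"])
    moreover have "ladder_open W (?T - C)"
      unfolding ladder_open_def
      by (auto simp: C_def intro!: exI[of _ "n-1"])
    moreover have "C \<subseteq> ?T" "x \<in> V" "V \<subseteq> C" "C \<subseteq> U"
      using Hi x n by (auto simp: V_def C_def)
    ultimately show ?thesis by blast
  next
    case Lo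
    obtain n where n: "\<forall>m\<le>n. \<forall>a\<in>W. Vx m a \<in> U \<and> (\<forall>b\<in>W. Ed m a b \<in> U)"
      using ladder_open_Lo[OF U] x Lo by auto
    define V where "V = {Lo} \<union> {Vx m a | m a. m \<le> n - 1 \<and> a \<in> W} \<union> {Ed m a b | m a b. m \<le> n - 1 \<and> a \<in> W \<and> b \<in> W}"
    define C where "C = {Lo} \<union> {Vx m a | m a. m \<le> n \<and> a \<in> W} \<union> {Ed m a b | m a b. m \<le> n - 1 \<and> a \<in> W \<and> b \<in> W}"
    have "ladder_open W V"
      unfolding ladder_open_def by (auto simp: V_def intro!: exI[of _ "n-1"])
    moreover have "ladder_open W (?T - C)"
      unfolding ladder_open_def
      by (auto simp: C_def intro!: exI[of _ "n+1"])
    moreover have "C \<subseteq> ?T" "x \<in> V" "V \<subseteq> C" "C \<subseteq> U"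
      using Lo x n by (auto simp: V_def C_def)
    ultimately show ?thesis by blast
  qed
  note nbhd = this
  show ?thesis
    unfolding neighbourhood_base_of_closedin[symmetric] neighbourhood_base_of
      openin_ladder_space closedin_ladder_space
  proof (intro allI impI)
    fix U x assume "ladder_open W U \<and> x \<in> U"
    then have "ladder_open W U" "x \<in> U" by simp_all
    from nbhd[OF this] show "\<exists>V C. ladder_open W V \<and> (C \<subseteq> ?T \<and> ladder_open W (?T - C)) \<and> x \<in> V \<and> V \<subseteq> C \<and> C \<subseteq> U"
      by (simp only: conj_assoc)
  qed
qed

section \<open>Real-valued maps on the ladder\<close>

lemma countable_ne_limit:
  fixes g :: "'a \<Rightarrow> real"
  assumes "\<And>e. e > 0 \<Longrightarrow> finite {b \<in> W. dist (g b) l \<ge> e}"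
  shows "countable {b \<in> W. g b \<noteq> l}"
proof -
  have "{b \<in> W. g b \<noteq> l} \<subseteq> (\<Union>k::nat. {b \<in> W. dist (g b) l \<ge> inverse (real (Suc k))})"
  proof
    fix b assume b: "b \<in> {b \<in> W. g b \<noteq> l}"
    then obtain k where "inverse (real (Suc k)) < dist (g b) l"
      using reals_Archimedean[of "dist (g b) l"] by auto
    with b show "b \<in> (\<Union>k::nat. {b \<in> W. dist (g b) l \<ge> inverse (real (Suc k))})"
      by (auto intro!: exI[of _ k])
  qed
  moreover have "countable (\<Union>k::nat. {b \<in> W. dist (g b) l \<ge> inverse (real (Suc k))})"
    by (intro countable_UN countable_finite assms countableI_type positive_imp_inverse_positive of_nat_0_less_iff[THEN iffD2] zero_less_Suc)
  ultimately show ?thesis by (rule countable_subset)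
qed

text \<open>\<open>u\<close> and \<open>v\<close> are the values at two consecutive levels, \<open>g a b\<close> the value at the edge between.\<close>

lemma level_step:
  fixes g :: "'a \<Rightarrow> 'a \<Rightarrow> real"
  assumes W: "uncountable W" and K: "closed K"
    and u: "\<And>a e. a \<in> W \<Longrightarrow> e > 0 \<Longrightarrow> finite {b \<in> W. dist (g a b) (u a) \<ge> e}"
    and v: "\<And>b e. b \<in> W \<Longrightarrow> e > 0 \<Longrightarrow> finite {a \<in> W. dist (g a b) (v b) \<ge> e}"
    and inf: "infinite {a \<in> W. u a \<in> K}"
  shows "infinite {b \<in> W. v b \<in> K}"
proof
  assume fin: "finite {b \<in> W. v b \<in> K}"
  \<comment> \<open>The exceptional edges of countably many vertices involve only countably many
    \<open>b\<close>. So some \<open>b\<close> with \<open>v b \<notin> K\<close> has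
    \<open>g a b = u a \<in> K\<close> for all \<open>a \<in> A\<close>, which keeps infinitely many
    of these values away from \<open>v b\<close>.\<close>
  obtain A where A: "A \<subseteq> {a \<in> W. u a \<in> K}" "infinite A" "countable A"
    using infinite_countable_subset'[OF inf] by blast
  have "countable (\<Union>a\<in>A. {b \<in> W. g a b \<noteq> u a})"
    using A u by (intro countable_UN countable_ne_limit) auto
  then have "countable ((\<Union>a\<in>A. {b \<in> W. g a b \<noteq> u a}) \<union> {b \<in> W. v b \<in> K})"
    using fin countable_finite by blast
  then have "\<not> W \<subseteq> (\<Union>a\<in>A. {b \<in> W. g a b \<noteq> u a}) \<union> {b \<in> W. v b \<in> K}"
    using W countable_subset by blast
  then obtain b where b: "b \<in> W" "v b \<notin> K" "\<And>a. a \<in> A \<Longrightarrow> g a b = u a"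
    by blast
  obtain e where e: "e > 0" "ball (v b) e \<subseteq> - K"
    using K b(2) open_contains_ball[of "- K"] by auto
  have "A \<subseteq> {a \<in> W. dist (g a b) (v b) \<ge> e}"
  proof
    fix a assume a: "a \<in> A"
    then have "g a b \<in> K" "a \<in> W" using A b by auto
    then have "g a b \<notin> ball (v b) e" using e by blast
    with \<open>a \<in> W\<close> show "a \<in> {a \<in> W. dist (g a b) (v b) \<ge> e}" by (simp add: dist_commute)
  qed
  then show False using v[OF b(1) e(1)] A(2) finite_subset by blast
qed

text \<open>Cut the real line at the midpoint of \<open>f Hi\<close> and \<open>f Lo\<close>. One
  closed ray contains infinitely many vertex values on level 0, hence on every level, hence both end
  values; two numbers on the same closed side of their midpoint are equal.\<close>

lemma ladder_ends_equal:
  assumes W: "uncountable W" and f: "continuous_map (ladder_space W) euclideanreal f"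
  shows "f Hi = f Lo"
proof -
  let ?T = "{x. set_ladder x \<subseteq> W}"
  have op: "ladder_open W {x \<in> ?T. f x \<in> U}" if "open U" for U
    using openin_continuous_map_preimage[OF f, of U] that
    by (simp add: topspace_ladder_space openin_ladder_space)
  have fin: "finite {b \<in> W. dist (f (Ed n a b)) (f (Vx n a)) \<ge> e}"
    "finite {b \<in> W. dist (f (Ed (n-1) b a)) (f (Vx n a)) \<ge> e}" if "a \<in> W" "e > 0" for n a e
  proof -
    have "Vx n a \<in> {x \<in> ?T. f x \<in> ball (f (Vx n a)) e}" using that by simp
    note fin = ladder_open_Vx[OF op[OF open_ball] this]
    show "finite {b \<in> W. dist (f (Ed n a b)) (f (Vx n a)) \<ge> e}"
      by (rule finite_subset[OF _ fin(1)]) (use that in \<open>auto simp: dist_commute\<close>)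
    show "finite {b \<in> W. dist (f (Ed (n-1) b a)) (f (Vx n a)) \<ge> e}"
      by (rule finite_subset[OF _ fin(2)]) (use that in \<open>auto simp: dist_commute\<close>)
  qed
  have up: "infinite {a \<in> W. f (Vx (n + 1) a) \<in> K}"
    if "closed K" "infinite {a \<in> W. f (Vx n a) \<in> K}" for n K
    by (rule level_step[OF W that(1) _ _ that(2), of "\<lambda>a b. f (Ed n a b)"])
       (use fin fin(2)[of _ _ "n+1"] in auto)
  \<comment> \<open>The same step read upside down: the edges below level \<open>n\<close> are taken
    with their endpoints exchanged.\<close>
  have down: "infinite {a \<in> W. f (Vx (n - 1) a) \<in> K}"
    if "closed K" "infinite {a \<in> W. f (Vx n a) \<in> K}" for n K
    by (rule level_step[OF W that(1) _ _ that(2), of "\<lambda>a b. f (Ed (n - 1) b a)"])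
       (use fin in auto)
  have both: "f Hi \<in> K \<and> f Lo \<in> K" if K: "closed K" and inf: "infinite {a \<in> W. f (Vx 0 a) \<in> K}" for K
  proof -
    have 1: "infinite {a \<in> W. f (Vx (int n) a) \<in> K}" for n
    proof (induction n)
      case (Suc n) show ?case using up[OF K Suc] by (simp add: add.commute)
    qed (use inf in simp)
    have 2: "infinite {a \<in> W. f (Vx (- int n) a) \<in> K}" for n
    proof (induction n)
      case (Suc n) show ?case using down[OF K Suc] by (simp add: minus_diff_commute)
    qed (use inf in simp)
    have o: "ladder_open W {x \<in> ?T. f x \<in> - K}" using op K by blast
    have "f Hi \<in> K"
    proof (rule ccontr)
      assume "f Hi \<notin> K"
      then have "Hi \<in> {x \<in> ?T. f x \<in> - K}" by simp
      from ladder_open_Hi[OF o this]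
      obtain n where n: "\<forall>m\<ge>n. \<forall>a\<in>W. Vx m a \<in> {x \<in> ?T. f x \<in> - K}" by auto
      have "int (nat n) \<ge> n" by simp
      then have "{a \<in> W. f (Vx (int (nat n)) a) \<in> K} = {}" using n by blast
      then show False using 1[of "nat n"] by (metis finite.emptyI)
    qed
    moreover have "f Lo \<in> K"
    proof (rule ccontr)
      assume "f Lo \<notin> K"
      then have "Lo \<in> {x \<in> ?T. f x \<in> - K}" by simp
      from ladder_open_Lo[OF o this]
      obtain n where n: "\<forall>m\<le>n. \<forall>a\<in>W. Vx m a \<in> {x \<in> ?T. f x \<in> - K}" by auto
      have "- int (nat (- n)) \<le> n" by simp
      then have "{a \<in> W. f (Vx (- int (nat (- n))) a) \<in> K} = {}" using n by blast
      then show False using 2[of "nat (- n)"] by (metis finite.emptyI)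
    qed
    ultimately show ?thesis by blast
  qed
  show ?thesis
  proof (rule ccontr)
    assume ne: "f Hi \<noteq> f Lo"
    define r where "r = (f Hi + f Lo) / 2"
    have "W \<subseteq> {a \<in> W. f (Vx 0 a) \<in> {..r}} \<union> {a \<in> W. f (Vx 0 a) \<in> {r..}}" by auto
    moreover have "infinite W" using W countable_finite by blast
    ultimately have "infinite {a \<in> W. f (Vx 0 a) \<in> {..r}} \<or> infinite {a \<in> W. f (Vx 0 a) \<in> {r..}}"
      using finite_subset by blast
    then have "(f Hi \<le> r \<and> f Lo \<le> r) \<or> (f Hi \<ge> r \<and> f Lo \<ge> r)"
      using both[of "{..r}"] both[of "{r..}"] by auto
    moreover have "2 * r = f Hi + f Lo" unfolding r_def by simp
    ultimately show False using ne by linarith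
  qed
qed

section \<open>Making all real-valued maps constant\<close>

text \<open>
  Given \<open>H\<close> with points \<open>a\<close> and \<open>b\<close> that real-valued maps cannot separate, start with one point and
  iterate the cone construction that turns \<open>S\<close> into \<open>S \<times> H\<close> with \<open>S \<times> {b}\<close> collapsed to a point,
  identifying \<open>S\<close> with \<open>S \<times> {a}\<close>. A point of the limit is a sequence that is finally \<open>a\<close>; the
  entries before its last \<open>b\<close> have been collapsed, and are normalised to \<open>b\<close>.
\<close>

lemma regular_space_closed_neighbourhood:
  assumes "regular_space X" "openin X U" "x \<in> U"
  obtains V C where "openin X V" "closedin X C" "x \<in> V" "V \<subseteq> C" "C \<subseteq> U"
proof -
  have "neighbourhood_base_of (closedin X) X" using assms(1) neighbourhood_base_of_closedin by metis
  then have "\<exists>V C. openin X V \<and> closedin X C \<and> x \<in> V \<and> V \<subseteq> C \<and> C \<subseteq> U"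
    using assms(2,3) unfolding neighbourhood_base_of by simp
  then show thesis using that by auto
qed

locale tower =
  fixes H :: "'h topology" and a b :: 'h
  assumes H_regular: "regular_space H" and H_t1: "t1_space H"
    and a_in: "a \<in> topspace H" and b_in: "b \<in> topspace H" and a_neq_b: "a \<noteq> b"
begin

text \<open>Entry 0 stands for the initial one-point stage; setting it to \<open>b\<close> gives
  every point a last \<open>b\<close>. The final clause is the normal form of collapsed
  entries.\<close>

definition points :: "(nat \<Rightarrow> 'h) set" where
  "points = {x. (\<forall>k. x k \<in> topspace H) \<and> (\<exists>m. \<forall>k>m. x k = a) \<and> x 0 = b \<and>
                (\<forall>k. x (Suc k) = b \<longrightarrow> x k = b)}"

definition last_b :: "(nat \<Rightarrow> 'h) \<Rightarrow> nat \<Rightarrow> bool" where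
  "last_b x n \<longleftrightarrow> x n = b \<and> (\<forall>k>n. x k \<noteq> b)"

definition tail_box :: "nat \<Rightarrow> (nat \<Rightarrow> 'h set) \<Rightarrow> (nat \<Rightarrow> 'h) set" where
  "tail_box n V = {y \<in> points. \<forall>k\<ge>n. y k \<in> V k}"

text \<open>Neighbourhoods start at the last \<open>b\<close>, since the entries before it are
  collapsed. This is a box topology: all later entries may be restricted at once, so that
  \<open>b\<close> can be forbidden at each of them.\<close>

definition tower_open :: "(nat \<Rightarrow> 'h) set \<Rightarrow> bool" where
  "tower_open U \<longleftrightarrow> U \<subseteq> points \<and>
     (\<forall>x\<in>U. \<exists>n V. last_b x n \<and> (\<forall>k\<ge>n. openin H (V k) \<and> x k \<in> V k) \<and> tail_box n V \<subseteq> U)"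

definition tower_space :: "(nat \<Rightarrow> 'h) topology" where
  "tower_space = topology tower_open"

lemma points_prefix:
  assumes "x \<in> points" "x n = b" "j \<le> n"
  shows "x j = b"
  using assms(3,2)
proof (induction rule: inc_induct)
  case (step k) then show ?case using assms(1) unfolding points_def by auto
qed simp

lemma last_b_exists:
  assumes "x \<in> points"
  obtains n where "last_b x n"
proof -
  obtain m where m: "\<And>k. k > m \<Longrightarrow> x k = a" and 0: "x 0 = b"
    using assms unfolding points_def by auto
  have bound: "k \<le> m" if "x k = b" for k
    using m[of k] that a_neq_b by (cases "k \<le> m") auto
  have "x (GREATEST k. x k = b) = b"
    using GreatestI_nat[of "\<lambda>k. x k = b", OF 0] bound by blast
  moreover have "x k \<noteq> b" if "k > (GREATEST k. x k = b)" for k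
    using Greatest_le_nat[of "\<lambda>k. x k = b" k m] bound that by (meson not_le)
  ultimately show thesis by (intro that[of "GREATEST k. x k = b"]) (simp add: last_b_def)
qed

lemma last_b_unique: "last_b x n \<Longrightarrow> last_b x m \<Longrightarrow> n = m"
  unfolding last_b_def by (metis linorder_neqE_nat)

lemma istopology_tower_open: "istopology tower_open"
  unfolding istopology_def
proof (intro conjI allI impI)
  fix S T assume S: "tower_open S" and T: "tower_open T"
  show "tower_open (S \<inter> T)"
    unfolding tower_open_def
  proof (intro conjI ballI)
    show "S \<inter> T \<subseteq> points" using S unfolding tower_open_def by auto
    fix x assume x: "x \<in> S \<inter> T"
    obtain n V where V: "last_b x n" "\<And>k. k \<ge> n \<Longrightarrow> openin H (V k) \<and> x k \<in> V k" "tail_box n V \<subseteq> S"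
      using S x unfolding tower_open_def by (metis IntD1)
    obtain m V' where V': "last_b x m" "\<And>k. k \<ge> m \<Longrightarrow> openin H (V' k) \<and> x k \<in> V' k" "tail_box m V' \<subseteq> T"
      using T x unfolding tower_open_def by (metis IntD2)
    have "m = n" using V(1) V'(1) last_b_unique by blast
    then show "\<exists>n V. last_b x n \<and> (\<forall>k\<ge>n. openin H (V k) \<and> x k \<in> V k) \<and> tail_box n V \<subseteq> S \<inter> T"
      using V V' by (intro exI[of _ n] exI[of _ "\<lambda>k. V k \<inter> V' k"]) (auto simp: tail_box_def)
  qed
next
  fix \<K> assume K: "\<forall>K\<in>\<K>. tower_open K"
  show "tower_open (\<Union>\<K>)"
    unfolding tower_open_def
  proof (intro conjI ballI)
    show "\<Union>\<K> \<subseteq> points" using K unfolding tower_open_def by auto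
    fix x assume "x \<in> \<Union>\<K>"
    then obtain S where S: "S \<in> \<K>" "x \<in> S" by blast
    with K obtain n V where "last_b x n" "\<forall>k\<ge>n. openin H (V k) \<and> x k \<in> V k" "tail_box n V \<subseteq> S"
      unfolding tower_open_def by metis
    with S show "\<exists>n V. last_b x n \<and> (\<forall>k\<ge>n. openin H (V k) \<and> x k \<in> V k) \<and> tail_box n V \<subseteq> \<Union>\<K>"
      by blast
  qed
qed

section \<open>Separation properties of the tower\<close>

lemma openin_tower_space: "openin tower_space U \<longleftrightarrow> tower_open U"
  unfolding tower_space_def by (simp only: topology_inverse'[OF istopology_tower_open])

text \<open>As later entries avoid \<open>b\<close>, the last \<open>b\<close> of a member comes at
  some \<open>m \<le> n\<close>. A neighbourhood of the member may leave the entries from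
  \<open>m\<close> to \<open>n - 1\<close> free and stay in the box.\<close>

lemma tail_box_open:
  assumes V: "\<And>k. k \<ge> n \<Longrightarrow> openin H (V k)" and nb: "\<And>k. k > n \<Longrightarrow> b \<notin> V k"
  shows "tower_open (tail_box n V)"
  unfolding tower_open_def
proof (intro conjI ballI)
  show "tail_box n V \<subseteq> points" unfolding tail_box_def by auto
  fix y assume y: "y \<in> tail_box n V"
  then have yp: "y \<in> points" unfolding tail_box_def by auto
  obtain m where m: "last_b y m" using last_b_exists[OF yp] .
  have "m \<le> n"
    using y nb[of m] m unfolding tail_box_def last_b_def by (cases "m \<le> n") auto
  let ?V = "\<lambda>k. if k < n then topspace H else V k"
  have "\<forall>k\<ge>m. openin H (?V k) \<and> y k \<in> ?V k"
    using y V yp unfolding tail_box_def points_def by auto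
  moreover have "tail_box m ?V \<subseteq> tail_box n V"
  proof
    fix z assume z: "z \<in> tail_box m ?V"
    have "z k \<in> V k" if "k \<ge> n" for k
    proof -
      have "k \<ge> m" using that \<open>m \<le> n\<close> by simp
      then have "z k \<in> ?V k" using z unfolding tail_box_def by blast
      then show ?thesis using that by simp
    qed
    then show "z \<in> tail_box n V" using z unfolding tail_box_def by simp
  qed
  ultimately show "\<exists>m V'. last_b y m \<and> (\<forall>k\<ge>m. openin H (V' k) \<and> y k \<in> V' k) \<and> tail_box m V' \<subseteq> tail_box n V"
    using m by (intro exI[of _ m] exI[of _ ?V] conjI)
qed

lemma topspace_tower_space: "topspace tower_space = points"
proof
  show "topspace tower_space \<subseteq> points"
    using openin_topspace[of tower_space] unfolding openin_tower_space tower_open_def by blast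
  have "tower_open points"
    unfolding tower_open_def
  proof (intro conjI ballI subset_refl)
    fix x assume x: "x \<in> points"
    obtain n where "last_b x n" using last_b_exists[OF x] .
    then show "\<exists>n V. last_b x n \<and> (\<forall>k\<ge>n. openin H (V k) \<and> x k \<in> V k) \<and> tail_box n V \<subseteq> points"
      using x by (intro exI[of _ n] exI[of _ "\<lambda>_. topspace H"]) (auto simp: tail_box_def points_def)
  qed
  then show "points \<subseteq> topspace tower_space"
    unfolding openin_tower_space[symmetric] by (rule openin_subset)
qed

lemma tail_box_closed:
  assumes C: "\<And>k. k \<ge> n \<Longrightarrow> closedin H (C k)" and nb: "\<And>k. k > n \<Longrightarrow> b \<notin> C k"
  shows "closedin tower_space (tail_box n C)"
  unfolding closedin_def topspace_tower_space openin_tower_space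
proof
  show "tail_box n C \<subseteq> points" unfolding tail_box_def by auto
  show "tower_open (points - tail_box n C)"
    unfolding tower_open_def
  proof (intro conjI ballI)
    fix y assume y: "y \<in> points - tail_box n C"
    then obtain i where i: "i \<ge> n" "y i \<notin> C i" unfolding tail_box_def by auto
    obtain m where m: "last_b y m" using last_b_exists y by blast
    \<comment> \<open>A neighbourhood of \<open>y\<close> controls only the entries from its last
      \<open>b\<close> on. If the failure at \<open>i\<close> comes earlier, then
      \<open>m > n\<close> and the entry \<open>y m = b\<close> fails as well.\<close>
    obtain k where k: "k \<ge> n" "k \<ge> m" "y k \<notin> C k"
    proof (cases "i \<ge> m")
      case False
      then show ?thesis using that[of m] i nb[of m] m unfolding last_b_def by auto
    qed (use i that in blast)
    let ?V = "\<lambda>j. if j = k then topspace H - C k else topspace H"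
    have "\<forall>j\<ge>m. openin H (?V j) \<and> y j \<in> ?V j"
      using y k C unfolding points_def by auto
    moreover have "tail_box m ?V \<subseteq> points - tail_box n C"
    proof
      fix z assume z: "z \<in> tail_box m ?V"
      then have "z k \<in> topspace H - C k" using k(2) unfolding tail_box_def by force
      then show "z \<in> points - tail_box n C" using z k(1) unfolding tail_box_def by auto
    qed
    ultimately show "\<exists>m V. last_b y m \<and> (\<forall>k\<ge>m. openin H (V k) \<and> y k \<in> V k) \<and> tail_box m V \<subseteq> points - tail_box n C"
      using m by (intro exI[of _ m] exI[of _ ?V] conjI)
  qed auto
qed

lemma regular_tower: "regular_space tower_space"
  unfolding neighbourhood_base_of_closedin[symmetric] neighbourhood_base_of
proof (intro allI impI)
  fix U x assume "openin tower_space U \<and> x \<in> U"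
  then have U: "tower_open U" and x: "x \<in> U" by (simp_all add: openin_tower_space)
  then have xp: "x \<in> points" unfolding tower_open_def by auto
  obtain n V where V: "last_b x n" "\<And>k. k \<ge> n \<Longrightarrow> openin H (V k) \<and> x k \<in> V k" "tail_box n V \<subseteq> U"
    using U x unfolding tower_open_def by metis
  have "\<exists>W C. openin H W \<and> closedin H C \<and> x k \<in> W \<and> W \<subseteq> C \<and> C \<subseteq> V k \<and> (k > n \<longrightarrow> b \<notin> C)"
    if "k \<ge> n" for k
  proof -
    \<comment> \<open>Deleting \<open>b\<close> from the later entries keeps \<open>x\<close> inside
      and makes the resulting boxes open and closed, respectively.\<close>
    let ?V = "if k > n then V k - {b} else V k"
    have "openin H ?V" "x k \<in> ?V"
      using V that H_t1 b_in unfolding t1_space_closedin_singleton last_b_def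
      by (auto intro: openin_diff)
    then obtain W C where "openin H W" "closedin H C" "x k \<in> W" "W \<subseteq> C" "C \<subseteq> ?V"
      by (rule regular_space_closed_neighbourhood[OF H_regular])
    then show ?thesis by (intro exI[of _ W] exI[of _ C]) (auto split: if_splits)
  qed
  then obtain W C where WC: "\<And>k. k \<ge> n \<Longrightarrow> openin H (W k) \<and> closedin H (C k) \<and> x k \<in> W k \<and>
      W k \<subseteq> C k \<and> C k \<subseteq> V k \<and> (k > n \<longrightarrow> b \<notin> C k)"
    by metis
  have "openin tower_space (tail_box n W)"
    unfolding openin_tower_space using WC by (intro tail_box_open) (auto dest: less_imp_le)
  moreover have "closedin tower_space (tail_box n C)"
    using WC by (intro tail_box_closed) (auto dest: less_imp_le)
  moreover have "x \<in> tail_box n W" using WC xp unfolding tail_box_def by auto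
  moreover have "tail_box n W \<subseteq> tail_box n C" using WC unfolding tail_box_def by blast
  moreover have "tail_box n C \<subseteq> U" using WC V(3) unfolding tail_box_def by blast
  ultimately show "\<exists>A B. openin tower_space A \<and> closedin tower_space B \<and> x \<in> A \<and> A \<subseteq> B \<and> B \<subseteq> U"
    by (intro exI[of _ "tail_box n W"] exI[of _ "tail_box n C"] conjI)
qed

lemma t1_tower: "t1_space tower_space"
  unfolding t1_space_def topspace_tower_space
proof (intro ballI impI)
  fix x y assume x: "x \<in> points" and y: "y \<in> points" and "x \<noteq> y"
  obtain n where n: "last_b x n" using last_b_exists[OF x] .
  \<comment> \<open>The box forbids \<open>y k\<close> wherever it differs from \<open>x k\<close>.
    Were \<open>y\<close> inside, it would agree with \<open>x\<close> from \<open>n\<close> on, and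
    up to \<open>n\<close> both are constantly \<open>b\<close>.\<close>
  define V where "V k = topspace H - (if k > n then {b} else {}) - (if y k \<noteq> x k then {y k} else {})" for k
  have V: "openin H (V k)" for k
    unfolding V_def using H_t1 b_in y
    by (auto simp: t1_space_closedin_singleton points_def intro!: openin_diff)
  have "tower_open (tail_box n V)"
    by (rule tail_box_open[OF V]) (simp add: V_def)
  moreover have "x \<in> tail_box n V"
    using x n unfolding tail_box_def V_def last_b_def points_def by auto
  moreover have "y \<notin> tail_box n V"
  proof
    assume "y \<in> tail_box n V"
    then have eq: "y k = x k" if "k \<ge> n" for k
      using that unfolding tail_box_def V_def by (cases "y k = x k") auto
    then have "y n = b" "x n = b" using n unfolding last_b_def by auto
    then have "y k = x k" if "k \<le> n" for k using points_prefix x y that by metis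
    with eq have "y = x" by (metis ext nle_le)
    with \<open>x \<noteq> y\<close> show False by simp
  qed
  ultimately show "\<exists>U. openin tower_space U \<and> x \<in> U \<and> y \<notin> U"
    unfolding openin_tower_space by blast
qed

section \<open>Real-valued maps on the tower\<close>

definition apex :: "nat \<Rightarrow> nat \<Rightarrow> 'h" where
  "apex n = (\<lambda>k. if k \<le> n then b else a)"

lemma apex_in_points: "apex n \<in> points"
  unfolding points_def apex_def using a_in b_in a_neq_b by (auto intro: exI[of _ n])

text \<open>The copy of \<open>H\<close> through a point \<open>x\<close> of stage \<open>m\<close>: it joins \<open>x\<close> (at \<open>a\<close>) to the next apex (at \<open>b\<close>).\<close>

definition fibre :: "(nat \<Rightarrow> 'h) \<Rightarrow> nat \<Rightarrow> 'h \<Rightarrow> nat \<Rightarrow> 'h" where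
  "fibre x m h = (if h = b then apex (Suc m) else x(Suc m := h))"

text \<open>Only entry \<open>Suc m\<close> varies, except that at \<open>h = b\<close> the earlier
  entries jump to \<open>b\<close>. The value there is \<open>apex (Suc m)\<close>, whose
  neighbourhoods start at \<open>Suc m\<close> and ignore the earlier entries.\<close>

lemma continuous_fibre:
  assumes x: "x \<in> points" and m: "\<And>k. k > m \<Longrightarrow> x k = a"
  shows "continuous_map H tower_space (fibre x m)"
proof -
  have in_points: "fibre x m h \<in> points" if "h \<in> topspace H" for h
  proof (cases "h = b")
    case False
    let ?y = "x(Suc m := h)"
    have le: "k \<le> m" if "x k = b" for k using m[of k] a_neq_b that by (cases "k \<le> m") auto
    have "?y k = b" if "?y (Suc k) = b" for k
    proof -
      have "k \<noteq> m" using that False by auto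
      then have "x (Suc k) = b" using that by simp
      moreover from this have "x k = b" using x unfolding points_def by simp
      ultimately show ?thesis using le[of "Suc k"] by simp
    qed
    moreover have "\<forall>k>Suc m. ?y k = a" using m by simp
    moreover have "?y 0 = b" "\<forall>k. ?y k \<in> topspace H" using x that unfolding points_def by simp_all
    ultimately have "?y \<in> points" unfolding points_def by blast
    with False show ?thesis unfolding fibre_def by simp
  qed (simp add: fibre_def apex_in_points)
  have "openin H {h \<in> topspace H. fibre x m h \<in> U}" if U: "tower_open U" for U
  proof (subst openin_subopen, intro ballI)
    fix h assume "h \<in> {h \<in> topspace H. fibre x m h \<in> U}"
    then have h: "h \<in> topspace H" "fibre x m h \<in> U" by auto
    obtain n V where V: "last_b (fibre x m h) n"
      "\<And>k. k \<ge> n \<Longrightarrow> openin H (V k) \<and> fibre x m h k \<in> V k" "tail_box n V \<subseteq> U"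
      using U h unfolding tower_open_def by metis
    \<comment> \<open>For \<open>h \<noteq> b\<close> the point \<open>b\<close> is removed, so that
      one case of \<open>fibre\<close> applies on all of \<open>N\<close>.\<close>
    define N where "N = V (Suc m) - (if h = b then {} else {b})"
    have n: "n \<le> Suc m" "h = b \<Longrightarrow> n = Suc m"
    proof -
      have "fibre x m h n = b" using V(1) unfolding last_b_def by simp
      then show "n \<le> Suc m"
        using m[of n] a_neq_b unfolding fibre_def apex_def by (cases "n \<le> Suc m") (auto split: if_splits)
      assume "h = b"
      then have "last_b (fibre x m h) (Suc m)"
        using a_neq_b unfolding last_b_def fibre_def apex_def by auto
      then show "n = Suc m" using V(1) last_b_unique by blast
    qed
    have "openin H N"
      unfolding N_def using V(2)[OF n(1)] H_t1 b_in
      by (auto simp: t1_space_closedin_singleton intro!: openin_diff)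
    moreover have "h \<in> N"
      using V(2)[OF n(1)] unfolding N_def fibre_def apex_def by (auto split: if_splits)
    moreover have "fibre x m h' \<in> U" if h': "h' \<in> N" for h'
    proof -
      have h'T: "h' \<in> topspace H" using h' openin_subset[OF \<open>openin H N\<close>] by blast
      have "fibre x m h' k \<in> V k" if k: "k \<ge> n" for k
      proof (cases "k = Suc m")
        case True
        then show ?thesis using h' unfolding N_def fibre_def apex_def by (auto split: if_splits)
      next
        case False
        then have "fibre x m h' k = fibre x m h k"
          using h' k n(2) m[of k] unfolding N_def fibre_def apex_def by (auto split: if_splits)
        then show ?thesis using V(2)[OF k] by simp
      qed
      then have "fibre x m h' \<in> tail_box n V" using in_points[OF h'T] unfolding tail_box_def by simp
      then show ?thesis using V(3) by blast
    qed
    ultimately show "\<exists>N. openin H N \<and> h \<in> N \<and> N \<subseteq> {h \<in> topspace H. fibre x m h \<in> U}"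
      using openin_subset by (intro exI[of _ N]) blast
  qed
  then show ?thesis
    unfolding continuous_map_def topspace_tower_space openin_tower_space using in_points by auto
qed

text \<open>A point that is \<open>a\<close> after \<open>m\<close> is joined to
  \<open>apex (Suc m)\<close> by a continuous image of \<open>H\<close>, whose two ends
  \<open>f\<close> cannot separate. Any two points share such an \<open>m\<close>, hence an
  apex.\<close>

lemma tower_constant:
  assumes ab: "\<And>g. continuous_map H euclideanreal g \<Longrightarrow> g a = g b"
    and f: "continuous_map tower_space euclideanreal f" and x: "x \<in> points" and y: "y \<in> points"
  shows "f x = f y"
proof -
  have apex: "f z = f (apex (Suc m))" if z: "z \<in> points" and m: "\<And>k. k > m \<Longrightarrow> z k = a" for z m
  proof -
    have "continuous_map H euclideanreal (f \<circ> fibre z m)"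
      by (rule continuous_map_compose[OF continuous_fibre[OF z m] f])
    from ab[OF this] have "f (fibre z m a) = f (fibre z m b)" by simp
    moreover have "fibre z m a = z" using m[of "Suc m"] a_neq_b by (auto simp: fibre_def)
    ultimately show ?thesis by (simp add: fibre_def)
  qed
  obtain m where m: "\<And>k. k > m \<Longrightarrow> x k = a" using x unfolding points_def by blast
  obtain n where n: "\<And>k. k > n \<Longrightarrow> y k = a" using y unfolding points_def by blast
  have "f x = f (apex (Suc (max m n)))" using m by (intro apex[OF x]) simp
  also have "\<dots> = f y" using n by (intro apex[OF y, symmetric]) simp
  finally show ?thesis .
qed

end

section \<open>Cardinality of the space with constant maps\<close>

lemma card_of_Times_ordLeq_infinite:
  "infinite C \<Longrightarrow> |A| \<le>o |C| \<Longrightarrow> |B| \<le>o |C| \<Longrightarrow> |A \<times> B| \<le>o |C|"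
  by (rule card_of_Sigma_ordLeq_infinite) auto

lemma card_of_Un_ordLeq_infinite':
  "infinite C \<Longrightarrow> |A| \<le>o |C| \<Longrightarrow> |B| \<le>o |C| \<Longrightarrow> |A \<union> B| \<le>o |C|"
  by (rule card_of_Un_ordLeq_infinite_Field[OF _ _ _ card_of_Card_order]) (simp_all add: Field_card_of)

lemma card_of_image_ordLeq: "|A| \<le>o |C| \<Longrightarrow> |f ` A| \<le>o |C|"
  using card_of_image ordLeq_transitive by blast

lemma finite_ordLess_infinite_card:
  assumes "finite A" "infinite C" shows "|A| <o |C|"
  by (rule finite_ordLess_infinite) (use assms in \<open>simp_all add: Field_card_of card_of_well_order_on\<close>)

lemma countable_ordLeq_infinite:
  assumes "countable A" "infinite C" shows "|A| \<le>o |C|"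
proof -
  obtain f :: "'a \<Rightarrow> nat" where f: "inj_on f A" using assms(1) unfolding countable_def by blast
  have "|A| \<le>o |UNIV :: nat set|" using f card_of_ordLeq[of A "UNIV :: nat set"] by blast
  moreover have "|UNIV :: nat set| \<le>o |C|" using assms(2) infinite_iff_card_of_nat by blast
  ultimately show ?thesis using ordLeq_transitive by blast
qed

lemma card_of_lists_ordLeq_infinite:
  assumes C: "infinite C" and A: "|A| \<le>o |C|"
  shows "|lists A| \<le>o |C|"
proof -
  let ?L = "\<lambda>n. {xs \<in> lists A. length xs = n}"
  have "|?L n| \<le>o |C|" for n
  proof (induction n)
    case 0
    have "?L 0 = {[]}" by auto
    then show ?case using C by (simp add: countable_ordLeq_infinite)
  next
    case (Suc n)
    have "?L (Suc n) \<subseteq> (\<lambda>(x, xs). x # xs) ` (A \<times> ?L n)"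
      by (auto simp: length_Suc_conv image_iff)
    then have "|?L (Suc n)| \<le>o |(\<lambda>(x, xs). x # xs) ` (A \<times> ?L n)|" by (rule card_of_mono1)
    moreover have "|(\<lambda>(x, xs). x # xs) ` (A \<times> ?L n)| \<le>o |C|"
      by (intro card_of_image_ordLeq card_of_Times_ordLeq_infinite C A Suc)
    ultimately show ?case by (rule ordLeq_transitive)
  qed
  then have "|\<Union>n. ?L n| \<le>o |C|"
    by (intro card_of_UNION_ordLeq_infinite C countable_ordLeq_infinite) auto
  moreover have "lists A = (\<Union>n. ?L n)" by auto
  ultimately show ?thesis by simp
qed

lemma card_of_topspace_ladder_space:
  assumes W: "infinite W"
  shows "|topspace (ladder_space W)| \<le>o |W|"
proof -
  let ?P = "\<lambda>n. {Hi, Lo} \<union> (Vx n ` W \<union> (\<lambda>(a, b). Ed n a b) ` (W \<times> W))"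
  have "topspace (ladder_space W) \<subseteq> (\<Union>n. ?P n)"
  proof
    fix x assume "x \<in> topspace (ladder_space W)"
    then have "set_ladder x \<subseteq> W" unfolding topspace_ladder_space by simp
    then show "x \<in> (\<Union>n. ?P n)" by (cases x) (auto simp: image_iff)
  qed
  then have "|topspace (ladder_space W)| \<le>o |\<Union>n. ?P n|" by (rule card_of_mono1)
  moreover have "|?P n| \<le>o |W|" for n
  proof -
    have WW: "|W| \<le>o |W|" by (rule card_of_mono1) simp
    have "|{Hi, Lo} :: 'a ladder set| \<le>o |W|" by (rule countable_ordLeq_infinite[OF _ W]) simp
    with WW show ?thesis
      by (intro card_of_Un_ordLeq_infinite' card_of_image_ordLeq card_of_Times_ordLeq_infinite W)
  qed
  then have "|\<Union>n. ?P n| \<le>o |W|"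
    by (intro card_of_UNION_ordLeq_infinite W countable_ordLeq_infinite) auto
  ultimately show ?thesis by (rule ordLeq_transitive)
qed

text \<open>A point is a finite list padded with \<open>a\<close>.\<close>

lemma (in tower) card_of_points:
  assumes "infinite C" "|topspace H| \<le>o |C|"
  shows "|points| \<le>o |C|"
proof -
  have "points \<subseteq> (\<lambda>l k. if k < length l then l ! k else a) ` lists (topspace H)"
  proof
    fix x assume x: "x \<in> points"
    then obtain m where m: "\<And>k. k > m \<Longrightarrow> x k = a" unfolding points_def by blast
    have "x = (\<lambda>k. if k < length (map x [0..<Suc m]) then map x [0..<Suc m] ! k else a)"
    proof
      fix k show "x k = (if k < length (map x [0..<Suc m]) then map x [0..<Suc m] ! k else a)"
        using m[of k] by (cases "k < Suc m") (simp_all del: upt_Suc)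
    qed
    moreover have "\<And>k. x k \<in> topspace H" using x unfolding points_def by simp
    then have "map x [0..<Suc m] \<in> lists (topspace H)" by (simp only: in_lists_conv_set set_map) blast
    ultimately show "x \<in> (\<lambda>l k. if k < length l then l ! k else a) ` lists (topspace H)" by blast
  qed
  then have "|points| \<le>o |(\<lambda>l k. if k < length l then l ! k else a) ` lists (topspace H)|"
    by (rule card_of_mono1)
  then show ?thesis
    using card_of_image_ordLeq[OF card_of_lists_ordLeq_infinite[OF assms]] ordLeq_transitive by blast
qed

text \<open>The space is the tower over the ladder with \<open>Lo\<close> as \<open>a\<close> and
  \<open>Hi\<close> as \<open>b\<close>; the apexes of two stages are the distinct points.\<close>

lemma exists_regular_space_constant_maps:
  fixes W :: "'w set"
  assumes W: "uncountable W"
  obtains Z :: "(nat \<Rightarrow> 'w ladder) topology" and z0 z1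
  where "regular_space Z" "t1_space Z" "|topspace Z| \<le>o |W|"
    "z0 \<in> topspace Z" "z1 \<in> topspace Z" "z0 \<noteq> z1"
    "\<And>f x y. continuous_map Z euclideanreal f \<Longrightarrow> x \<in> topspace Z \<Longrightarrow> y \<in> topspace Z \<Longrightarrow> f x = f y"
proof -
  interpret tower "ladder_space W" Lo Hi
    by unfold_locales (simp_all add: regular_space_ladder t1_space_ladder topspace_ladder_space)
  have W': "infinite W" using W countable_finite by blast
  have card: "|topspace tower_space| \<le>o |W|"
    unfolding topspace_tower_space by (intro card_of_points card_of_topspace_ladder_space W')
  have "apex 0 1 \<noteq> apex 1 1" by (simp add: apex_def)
  then have ne: "apex 0 \<noteq> apex 1" by fastforce
  have const: "f x = f y" if "continuous_map tower_space euclideanreal f"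
    "x \<in> topspace tower_space" "y \<in> topspace tower_space" for f x y
  proof (rule tower_constant[OF _ that(1)])
    show "g Lo = g Hi" if "continuous_map (ladder_space W) euclideanreal g" for g
      by (rule ladder_ends_equal[OF W that, symmetric])
  qed (use that(2,3) in \<open>simp_all add: topspace_tower_space\<close>)
  have apex: "apex 0 \<in> topspace tower_space" "apex 1 \<in> topspace tower_space"
    unfolding topspace_tower_space by (rule apex_in_points)+
  show thesis
    by (rule that[OF regular_tower t1_tower card apex ne const])
qed

section \<open>Independent families\<close>

text \<open>
  A list of triples \<open>(P, N, z)\<close> denotes a step function on sets: the first triple whose cell
  \<open>{A. set P \<subseteq> A \<and> set N \<inter> A = {}}\<close> contains the argument determines the value.
\<close>

fun step :: "'z \<Rightarrow> ('w list \<times> 'w list \<times> 'z) list \<Rightarrow> 'w set \<Rightarrow> 'z" where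
  "step d [] A = d"
| "step d ((P, N, z) # l) A = (if set P \<subseteq> A \<and> set N \<inter> A = {} then z else step d l A)"

abbreviation codes :: "'w set \<Rightarrow> 'z set \<Rightarrow> ('w list \<times> 'w list \<times> 'z) list set" where
  "codes W T \<equiv> lists (lists W \<times> lists W \<times> T)"

lemma append_Cons_in_codes:
  "l1 @ (P, N, z) # l2 \<in> codes W T \<longleftrightarrow>
     l1 \<in> codes W T \<and> P \<in> lists W \<and> N \<in> lists W \<and> z \<in> T \<and> l2 \<in> codes W T"
  by (simp only: append_in_lists_conv Cons_in_lists_iff mem_Sigma_iff conj_assoc)

lemma step_in: "l \<in> codes W T \<Longrightarrow> d \<in> T \<Longrightarrow> step d l A \<in> T"
  by (induction d l A rule: step.induct) auto

lemma card_of_codes: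
  assumes "infinite C" "|W| \<le>o |C|" "|T| \<le>o |C|"
  shows "|codes W T| \<le>o |C|"
  by (intro card_of_lists_ordLeq_infinite card_of_Times_ordLeq_infinite assms)

text \<open>Each \<open>B\<close> in \<open>F\<close> differs from \<open>A\<close> at some element
  of \<open>W\<close>, which \<open>P\<close> demands if it lies in \<open>A\<close> and
  \<open>N\<close> forbids otherwise.\<close>

lemma separating_cell:
  assumes "finite F" "F \<subseteq> Pow W" "A \<subseteq> W" "A \<notin> F"
  shows "\<exists>P N. P \<in> lists W \<and> N \<in> lists W \<and> set P \<subseteq> A \<and> set N \<inter> A = {} \<and>
           (\<forall>B\<in>F. \<not> (set P \<subseteq> B \<and> set N \<inter> B = {}))"
  using assms
proof (induction F rule: finite_induct)
  case empty
  show ?case by (rule exI[of _ "[]"], rule exI[of _ "[]"]) simp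
next
  case (insert B F)
  have "\<exists>P N. P \<in> lists W \<and> N \<in> lists W \<and> set P \<subseteq> A \<and> set N \<inter> A = {} \<and>
      (\<forall>B\<in>F. \<not> (set P \<subseteq> B \<and> set N \<inter> B = {}))"
    using insert.prems by (intro insert.IH) simp_all
  then obtain P N where PN: "P \<in> lists W" "N \<in> lists W" "set P \<subseteq> A" "set N \<inter> A = {}"
      "\<forall>B\<in>F. \<not> (set P \<subseteq> B \<and> set N \<inter> B = {})"
    by (elim exE conjE)
  from insert.prems have "A \<noteq> B" "B \<subseteq> W" by auto
  then consider w where "w \<in> A" "w \<notin> B" | w where "w \<in> B" "w \<notin> A" by blast
  then show ?case
  proof cases
    case (1 w)
    have "w \<in> W" using 1(1) insert.prems(2) by (rule rev_subsetD)
    moreover have "\<forall>C\<in>insert B F. \<not> (set (w # P) \<subseteq> C \<and> set N \<inter> C = {})"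
      using PN(5) 1(2) by simp
    ultimately show ?thesis
      using PN(1-4) 1(1) by (intro exI[of _ "w # P"] exI[of _ N] conjI) simp_all
  next
    case (2 w)
    have "w \<in> W" using 2(1) \<open>B \<subseteq> W\<close> by (rule rev_subsetD)
    moreover have "\<forall>C\<in>insert B F. \<not> (set P \<subseteq> C \<and> set (w # N) \<inter> C = {})"
      using PN(5) 2(1) by simp
    ultimately show ?thesis
      using PN(1-4) 2(2) by (intro exI[of _ P] exI[of _ "w # N"] conjI) simp_all
  qed
qed

text \<open>The triple for a new set goes to the front, with a cell that misses the sets already
  treated, so their values are still read from the rest of the list.\<close>

lemma step_interpolation:
  assumes "finite F" "F \<subseteq> Pow W" "v ` F \<subseteq> T"
  shows "\<exists>l\<in>codes W T. \<forall>A\<in>F. step d l A = v A"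
  using assms
proof (induction F rule: finite_induct)
  case empty
  show ?case by (rule bexI[of _ "[]"]) simp_all
next
  case (insert A F)
  then obtain l where l: "l \<in> codes W T" "\<forall>A\<in>F. step d l A = v A" by auto
  obtain P N where PN: "P \<in> lists W" "N \<in> lists W" "set P \<subseteq> A" "set N \<inter> A = {}"
      "\<forall>B\<in>F. \<not> (set P \<subseteq> B \<and> set N \<inter> B = {})"
    using separating_cell[OF insert.hyps(1) _ _ insert.hyps(2), of W] insert.prems(1)
    unfolding insert_subset Pow_iff by metis
  have "\<forall>B\<in>insert A F. step d ((P, N, v A) # l) B = v B"
  proof
    fix B assume "B \<in> insert A F"
    then consider "B = A" | "B \<in> F" by blast
    then show "step d ((P, N, v A) # l) B = v B"
    proof cases
      case 2
      then have "\<not> (set P \<subseteq> B \<and> set N \<inter> B = {})" "step d l B = v B"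
        using PN(5) l(2) by simp_all
      then show ?thesis by (simp only: step.simps if_False)
    qed (use PN(3,4) in simp)
  qed
  moreover have "(P, N, v A) # l \<in> codes W T" using PN(1,2) l(1) insert.prems by simp
  ultimately show ?case by (rule rev_bexI[rotated])
qed

text \<open>Whether \<open>A\<close> stops at the marked triple does not depend on \<open>z\<close>.
  In each coordinate the dependence on \<open>z\<close> is thus the identity or constant, which
  gives continuity.\<close>

lemma step_value_cases:
  "(\<forall>z. step d (l1 @ (P, N, z) # l2) A = z) \<or> (\<exists>c. \<forall>z. step d (l1 @ (P, N, z) # l2) A = c)"
proof (induction l1)
  case Nil
  show ?case
    by (cases "set P \<subseteq> A \<and> set N \<inter> A = {}")
       (simp_all only: append_Nil step.simps if_True if_False simp_thms)
next
  case (Cons q l1)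
  obtain P' N' z' where q: "q = (P', N', z')" by (rule prod_cases3)
  show ?case
    using Cons unfolding q
    by (cases "set P' \<subseteq> A \<and> set N' \<inter> A = {}")
       (simp_all only: append_Cons step.simps if_True if_False simp_thms)
qed

lemma step_constant:
  "step d (map (\<lambda>(P, N, z). (P, N, d)) l) A = d"
  by (induction l) auto

section \<open>Maximal independent families\<close>

definition independent_family :: "'z topology \<Rightarrow> 'm set \<Rightarrow> ('m \<Rightarrow> 'z) set \<Rightarrow> bool" where
  "independent_family Z M \<Phi> \<longleftrightarrow> \<Phi> \<subseteq> M \<rightarrow>\<^sub>E topspace Z \<and>
     (\<forall>F B. finite F \<longrightarrow> F \<subseteq> \<Phi> \<longrightarrow> (\<forall>\<phi>\<in>F. openin Z (B \<phi>) \<and> B \<phi> \<noteq> {}) \<longrightarrow>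
        (\<exists>m\<in>M. \<forall>\<phi>\<in>F. \<phi> m \<in> B \<phi>))"

lemma independent_familyD:
  assumes \<Phi>: "independent_family Z M \<Phi>" and F: "finite F" "F \<subseteq> \<Phi>"
    and B: "\<And>\<phi>. \<phi> \<in> F \<Longrightarrow> openin Z (B \<phi>)" "\<And>\<phi>. \<phi> \<in> F \<Longrightarrow> B \<phi> \<noteq> {}"
  shows "\<exists>m\<in>M. \<forall>\<phi>\<in>F. \<phi> m \<in> B \<phi>"
proof -
  have "\<forall>F B. finite F \<longrightarrow> F \<subseteq> \<Phi> \<longrightarrow> (\<forall>\<phi>\<in>F. openin Z (B \<phi>) \<and> B \<phi> \<noteq> {}) \<longrightarrow>
        (\<exists>m\<in>M. \<forall>\<phi>\<in>F. \<phi> m \<in> B \<phi>)"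
    using \<Phi> unfolding independent_family_def by (rule conjunct2)
  from this[rule_format, OF F, of B] B show ?thesis by simp
qed

text \<open>Each instance of independence concerns finitely many functions, so independence passes
  to unions of chains.\<close>

lemma maximal_independent:
  assumes "independent_family Z M \<Phi>0"
  obtains \<Phi> where "\<Phi>0 \<subseteq> \<Phi>" "independent_family Z M \<Phi>"
    "\<And>\<phi>. independent_family Z M (insert \<phi> \<Phi>) \<Longrightarrow> \<phi> \<in> \<Phi>"
proof -
  let ?S = "{\<Phi>. \<Phi>0 \<subseteq> \<Phi> \<and> independent_family Z M \<Phi>}"
  have "\<exists>\<Phi>\<in>?S. \<forall>\<Psi>\<in>?S. \<Phi> \<subseteq> \<Psi> \<longrightarrow> \<Psi> = \<Phi>"
  proof (rule subset_Zorn_nonempty)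
    show "?S \<noteq> {}" using assms by blast
    fix \<C> assume ne: "\<C> \<noteq> {}" and ch: "subset.chain ?S \<C>"
    have C: "\<Phi>0 \<subseteq> \<Psi>" "independent_family Z M \<Psi>" if "\<Psi> \<in> \<C>" for \<Psi>
      using ch that unfolding subset.chain_def by auto
    have "independent_family Z M (\<Union>\<C>)"
      unfolding independent_family_def
    proof (intro conjI allI impI)
      show "\<Union>\<C> \<subseteq> M \<rightarrow>\<^sub>E topspace Z" using C(2) unfolding independent_family_def by auto
      fix F B assume F: "finite F" "F \<subseteq> \<Union>\<C>" "\<forall>\<phi>\<in>F. openin Z (B \<phi>) \<and> B \<phi> \<noteq> {}"
      obtain \<Psi> where \<Psi>: "\<Psi> \<in> \<C>" "F \<subseteq> \<Psi>"
        using finite_subset_Union_chain[OF F(1,2) ne] ch by blast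
      show "\<exists>m\<in>M. \<forall>\<phi>\<in>F. \<phi> m \<in> B \<phi>"
        by (rule independent_familyD[OF C(2)[OF \<Psi>(1)] F(1) \<Psi>(2), of B]) (use F(3) in auto)
    qed
    then show "\<Union>\<C> \<in> ?S" using C(1) ne by auto
  qed
  then obtain \<Phi> where \<Phi>: "\<Phi> \<in> ?S" "\<forall>\<Psi>\<in>?S. \<Phi> \<subseteq> \<Psi> \<longrightarrow> \<Psi> = \<Phi>" by blast
  show thesis
  proof (rule that)
    fix \<phi> assume "independent_family Z M (insert \<phi> \<Phi>)"
    then have "insert \<phi> \<Phi> = \<Phi>" using \<Phi> by blast
    then show "\<phi> \<in> \<Phi>" by blast
  qed (use \<Phi>(1) in auto)
qed

text \<open>
  The functions are step functions along an independent family, altered on small sets; thanks to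
  the alterations every small set is nowhere dense in the topology that the family generates.
\<close>

lemma exists_independent_family:
  fixes M :: "'m set" and Z :: "'z topology"
  assumes M: "infinite M" and T: "|topspace Z| \<le>o |M|"
    and z: "z0 \<in> topspace Z" "z1 \<in> topspace Z" "z0 \<noteq> z1"
  obtains \<Phi> where "independent_family Z M \<Phi>"
    "\<And>I. I \<subseteq> M \<Longrightarrow> |I| <o |M| \<Longrightarrow> infinite {\<phi> \<in> \<Phi>. \<forall>m\<in>I. \<phi> m = z0}"
    "\<And>m m'. m \<in> M \<Longrightarrow> m' \<in> M \<Longrightarrow> m \<noteq> m' \<Longrightarrow> \<exists>\<phi>\<in>\<Phi>. \<phi> m \<noteq> \<phi> m'"
proof -
  let ?T = "topspace Z"
  define L where "L = codes M ?T"
  have "|L| \<le>o |M|" unfolding L_def using M T by (intro card_of_codes card_of_mono1) auto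
  moreover have "L \<noteq> {}" unfolding L_def by auto
  ultimately have "|M| =o |M \<times> L|" by (intro card_of_Times_infinite_simps(2)[OF M])
  \<comment> \<open>Every list in \<open>L\<close> is attached to \<open>|M|\<close> many points,
    which leaves room after a small set of altered points is discarded.\<close>
  then obtain \<beta> where \<beta>: "bij_betw \<beta> M (M \<times> L)" using card_of_ordIso[of M "M \<times> L"] by auto
  \<comment> \<open>The function is forced to \<open>z0\<close> on \<open>I\<close> and to
    \<open>z1\<close> on the rest of \<open>J\<close>; the number supplies infinitely many functions
    with the same alterations.\<close>
  define Idx :: "('m set \<times> 'm set \<times> nat) set"
    where "Idx = {(I, J, n). I \<subseteq> M \<and> J \<subseteq> M \<and> |I \<union> J| <o |M|}"
  have PM: "infinite (Pow M)" using M by simp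
  have "|Pow M \<times> Pow M \<times> (UNIV :: nat set)| \<le>o |Pow M|"
    by (intro card_of_Times_ordLeq_infinite countable_ordLeq_infinite PM card_of_mono1) auto
  moreover have "|Idx| \<le>o |Pow M \<times> Pow M \<times> (UNIV :: nat set)|"
    by (intro card_of_mono1) (auto simp: Idx_def)
  ultimately have "|Idx| \<le>o |Pow M|" by (rule ordLeq_transitive[rotated])
  then obtain \<iota> where \<iota>: "inj_on \<iota> Idx" "\<iota> ` Idx \<subseteq> Pow M" using card_of_ordLeq[of Idx "Pow M"] by auto
  define \<psi> where "\<psi> i = (\<lambda>m\<in>M. if m \<in> fst i then z0 else if m \<in> fst (snd i) then z1
                             else step z0 (snd (\<beta> m)) (\<iota> i))" for i
  have \<beta>L: "snd (\<beta> m) \<in> L" if "m \<in> M" for m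
    using \<beta> that unfolding bij_betw_def by (metis imageI mem_Sigma_iff prod.collapse)
  have \<psi>_in: "\<psi> i \<in> M \<rightarrow>\<^sub>E ?T" for i
    unfolding \<psi>_def using z step_in[OF \<beta>L[unfolded L_def] z(1)] by auto
  have interpol: "\<exists>m\<in>M. \<forall>i\<in>K. \<psi> i m = v i"
    if K: "finite K" "K \<subseteq> Idx" and v: "\<And>i. i \<in> K \<Longrightarrow> v i \<in> ?T" for K v
  proof -
    have inj: "inj_on \<iota> K" using \<iota>(1) K(2) inj_on_subset by blast
    have "\<exists>l\<in>codes M ?T. \<forall>A\<in>\<iota> ` K. step z0 l A = v (inv_into K \<iota> A)"
    proof (rule step_interpolation)
      show "\<iota> ` K \<subseteq> Pow M" using \<iota> K by blast
      show "(\<lambda>A. v (inv_into K \<iota> A)) ` \<iota> ` K \<subseteq> ?T" using v inj by auto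
    qed (use K in simp)
    then obtain l where l: "l \<in> L" "\<And>i. i \<in> K \<Longrightarrow> step z0 l (\<iota> i) = v i"
      unfolding L_def using inj by auto
    define bad where "bad = (\<Union>i\<in>K. fst i \<union> fst (snd i))"
    have "|bad| <o |M|"
      unfolding bad_def using K
    proof (induction K rule: finite_induct)
      case empty
      show ?case using M by (simp add: finite_ordLess_infinite_card)
    next
      case (insert i K)
      have "|fst i \<union> fst (snd i)| <o |M|" using insert.prems unfolding Idx_def by auto
      with insert show ?case by (simp add: card_of_Un_ordLess_infinite[OF M])
    qed
    \<comment> \<open>The points that carry the list \<open>l\<close>: there are at least
      \<open>|M|\<close> of them, so one lies outside \<open>bad\<close>, where no function indexed
      by \<open>K\<close> is altered.\<close>
    let ?good = "inv_into M \<beta> ` (M \<times> {l})"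
    have "M \<times> {l} \<subseteq> \<beta> ` M" using l(1) \<beta> by (auto simp: bij_betw_def)
    then have "inj_on (inv_into M \<beta>) (M \<times> {l})" by (rule inj_on_inv_into)
    then have "inj_on (\<lambda>m. inv_into M \<beta> (m, l)) M" by (auto simp: inj_on_def)
    then have "|M| \<le>o |?good|"
      by (intro iffD1[OF card_of_ordLeq] exI conjI) auto
    have "\<not> ?good \<subseteq> bad"
    proof
      assume "?good \<subseteq> bad"
      then have "|?good| \<le>o |bad|" by (rule card_of_mono1)
      with \<open>|M| \<le>o |?good|\<close> have "|M| \<le>o |bad|" by (rule ordLeq_transitive)
      with \<open>|bad| <o |M|\<close> show False using not_ordLess_ordLeq by blast
    qed
    then obtain p where p: "p \<in> M" "inv_into M \<beta> (p, l) \<notin> bad" by auto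
    let ?m = "inv_into M \<beta> (p, l)"
    have "(p, l) \<in> \<beta> ` M" using \<beta> p l by (simp add: bij_betw_def)
    then have m: "?m \<in> M" "\<beta> ?m = (p, l)" by (auto intro: inv_into_into f_inv_into_f)
    have "\<psi> i ?m = v i" if "i \<in> K" for i
      using p(2) m l(2)[OF that] that unfolding \<psi>_def bad_def by auto
    then show ?thesis using m(1) by blast
  qed
  have \<psi>_inj: "inj_on \<psi> Idx"
  proof (rule inj_onI, rule ccontr)
    fix i j assume ij: "i \<in> Idx" "j \<in> Idx" "\<psi> i = \<psi> j" "i \<noteq> j"
    let ?v = "\<lambda>k. if k = i then z0 else z1"
    have "?v k \<in> ?T" for k using z by simp
    then have "\<exists>m\<in>M. \<forall>k\<in>{i, j}. \<psi> k m = ?v k" using ij(1,2) by (intro interpol) simp_all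
    then obtain m where "\<forall>k\<in>{i, j}. \<psi> k m = ?v k" by (rule bexE)
    then have "\<psi> i m = z0" "\<psi> j m = z1" using ij(4) by simp_all
    with ij(3) z(3) show False by simp
  qed
  show thesis
  proof (rule that[of "\<psi> ` Idx"])
    show "independent_family Z M (\<psi> ` Idx)"
      unfolding independent_family_def
    proof (intro conjI allI impI)
      show "\<psi> ` Idx \<subseteq> M \<rightarrow>\<^sub>E ?T" using \<psi>_in by blast
      fix F B assume F: "finite F" "F \<subseteq> \<psi> ` Idx" "\<forall>\<phi>\<in>F. openin Z (B \<phi>) \<and> B \<phi> \<noteq> {}"
      obtain K where K: "K \<subseteq> Idx" "finite K" "F = \<psi> ` K"
        using finite_subset_image[OF F(1,2)] by blast
      have "\<forall>i\<in>K. \<exists>z. z \<in> B (\<psi> i)" using F(3) K(3) by auto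
      then obtain w where w: "\<forall>i\<in>K. w i \<in> B (\<psi> i)" by (metis bchoice)
      have "w i \<in> ?T" if "i \<in> K" for i
        using F(3) K(3) that w openin_subset[of Z "B (\<psi> i)"] by blast
      then have "\<exists>m\<in>M. \<forall>i\<in>K. \<psi> i m = w i" by (rule interpol[OF K(2,1)])
      then obtain m where m: "m \<in> M" "\<forall>i\<in>K. \<psi> i m = w i" by (rule bexE)
      then have "\<forall>\<phi>\<in>F. \<phi> m \<in> B \<phi>" using w unfolding K(3) by simp
      with m(1) show "\<exists>m\<in>M. \<forall>\<phi>\<in>F. \<phi> m \<in> B \<phi>" by (rule rev_bexI)
    qed
  next
    fix I assume I: "I \<subseteq> M" "|I| <o |M|"
    have Idx: "(I, {}, n) \<in> Idx" for n using I unfolding Idx_def by simp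
    have "inj (\<lambda>n. \<psi> (I, {}, n))"
      using Idx \<psi>_inj by (auto simp: inj_on_def)
    then have "infinite (range (\<lambda>n. \<psi> (I, {}, n)))" using range_inj_infinite by blast
    moreover have "range (\<lambda>n. \<psi> (I, {}, n)) \<subseteq> {\<phi> \<in> \<psi> ` Idx. \<forall>m\<in>I. \<phi> m = z0}"
    proof
      fix \<phi> assume "\<phi> \<in> range (\<lambda>n. \<psi> (I, {}, n))"
      then obtain n where \<phi>: "\<phi> = \<psi> (I, {}, n)" by blast
      have "\<forall>m\<in>I. \<phi> m = z0" unfolding \<phi> \<psi>_def using I(1) by auto
      then show "\<phi> \<in> {\<phi> \<in> \<psi> ` Idx. \<forall>m\<in>I. \<phi> m = z0}" using Idx unfolding \<phi> by simp
    qed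
    ultimately show "infinite {\<phi> \<in> \<psi> ` Idx. \<forall>m\<in>I. \<phi> m = z0}" using finite_subset by blast
  next
    fix m m' assume m: "m \<in> M" "m' \<in> M" "m \<noteq> m'"
    have "|{m, m'}| <o |M|" using M by (intro finite_ordLess_infinite_card) auto
    then have "({m}, {m'}, 0) \<in> Idx" using m unfolding Idx_def by simp
    moreover have "\<psi> ({m}, {m'}, 0) m \<noteq> \<psi> ({m}, {m'}, 0) m'" using m z unfolding \<psi>_def by auto
    ultimately show "\<exists>\<phi>\<in>\<psi> ` Idx. \<phi> m \<noteq> \<phi> m'" by blast
  qed
qed

section \<open>The irresolvable space\<close>

text \<open>\<open>code\<close> replaces the index set of the product by subsets of
  \<open>W\<close>, on which step functions are defined. \<open>escape\<close> serves to make open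
  sets large, \<open>separates\<close> to make evaluation injective.\<close>

locale generic_family =
  fixes Z :: "'z topology" and M :: "'m set" and W :: "'w set" and \<Phi> :: "('m \<Rightarrow> 'z) set"
    and z0 z1 :: 'z and code :: "('m \<Rightarrow> 'z) \<Rightarrow> 'w set"
  assumes Z_regular: "regular_space Z" and Z_t1: "t1_space Z"
    and z0: "z0 \<in> topspace Z" and z1: "z1 \<in> topspace Z" and z01: "z0 \<noteq> z1"
    and Z_const: "\<And>f x y. continuous_map Z euclideanreal f \<Longrightarrow>
                    x \<in> topspace Z \<Longrightarrow> y \<in> topspace Z \<Longrightarrow> f x = f y"
    and W: "infinite W" and Z_card: "|topspace Z| \<le>o |W|" and WM: "|W| <o |M|"
    and indep: "independent_family Z M \<Phi>"
    and maximal: "\<And>\<phi>. independent_family Z M (insert \<phi> \<Phi>) \<Longrightarrow> \<phi> \<in> \<Phi>"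
    and escape: "\<And>I. I \<subseteq> M \<Longrightarrow> |I| <o |M| \<Longrightarrow> infinite {\<phi> \<in> \<Phi>. \<forall>m\<in>I. \<phi> m = z0}"
    and separates: "\<And>m m'. m \<in> M \<Longrightarrow> m' \<in> M \<Longrightarrow> m \<noteq> m' \<Longrightarrow> \<exists>\<phi>\<in>\<Phi>. \<phi> m \<noteq> \<phi> m'"
    and code_inj: "inj_on code \<Phi>" and code_in: "code ` \<Phi> \<subseteq> Pow W"
begin

definition eval :: "'m \<Rightarrow> ('m \<Rightarrow> 'z) \<Rightarrow> 'z" where
  "eval m = (\<lambda>\<phi>\<in>\<Phi>. \<phi> m)"

definition step_point :: "('w list \<times> 'w list \<times> 'z) list \<Rightarrow> ('m \<Rightarrow> 'z) \<Rightarrow> 'z" where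
  "step_point l = (\<lambda>\<phi>\<in>\<Phi>. step z0 l (code \<phi>))"

definition step_points :: "(('m \<Rightarrow> 'z) \<Rightarrow> 'z) set" where
  "step_points = step_point ` codes W (topspace Z)"

definition X :: "(('m \<Rightarrow> 'z) \<Rightarrow> 'z) topology" where
  "X = subtopology (product_topology (\<lambda>_. Z) \<Phi>) (eval ` M \<union> step_points)"

definition cylinder :: "('m \<Rightarrow> 'z) set \<Rightarrow> (('m \<Rightarrow> 'z) \<Rightarrow> 'z set) \<Rightarrow> (('m \<Rightarrow> 'z) \<Rightarrow> 'z) set" where
  "cylinder F B = {x \<in> topspace X. \<forall>\<phi>\<in>F. x \<phi> \<in> B \<phi>}"

lemma \<Phi>_in: "\<phi> \<in> \<Phi> \<Longrightarrow> m \<in> M \<Longrightarrow> \<phi> m \<in> topspace Z"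
  using indep unfolding independent_family_def by auto

lemma topspace_X: "topspace X = eval ` M \<union> step_points"
proof -
  have "eval m \<in> \<Phi> \<rightarrow>\<^sub>E topspace Z" if "m \<in> M" for m
    using \<Phi>_in that unfolding eval_def by auto
  moreover have "step_point l \<in> \<Phi> \<rightarrow>\<^sub>E topspace Z" if "l \<in> codes W (topspace Z)" for l
    using step_in[OF that z0] unfolding step_point_def by auto
  ultimately show ?thesis
    unfolding X_def topspace_subtopology topspace_product_topology step_points_def by blast
qed

lemma X_in_PiE: "x \<in> topspace X \<Longrightarrow> x \<in> \<Phi> \<rightarrow>\<^sub>E topspace Z"
  unfolding X_def topspace_subtopology topspace_product_topology by simp

lemma eval_in_X: "m \<in> M \<Longrightarrow> eval m \<in> topspace X"
  unfolding topspace_X by blast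

lemma eval_apply: "\<phi> \<in> \<Phi> \<Longrightarrow> eval m \<phi> = \<phi> m"
  unfolding eval_def by simp

lemma inj_eval: "inj_on eval M"
proof (rule inj_onI, rule ccontr)
  fix m m' assume m: "m \<in> M" "m' \<in> M" "eval m = eval m'" "m \<noteq> m'"
  obtain \<phi> where "\<phi> \<in> \<Phi>" "\<phi> m \<noteq> \<phi> m'" using separates[OF m(1,2,4)] by blast
  with m(3) eval_apply show False by metis
qed

lemma regular_X: "regular_space X"
  unfolding X_def using Z_regular by (intro regular_space_subtopology) (simp add: regular_space_product_topology)

lemma t1_X: "t1_space X"
  unfolding X_def using Z_t1 by (intro t1_space_subtopology) (simp add: t1_space_product_topology)

lemma open_cylinder:
  assumes F: "finite F" "F \<subseteq> \<Phi>" and B: "\<And>\<phi>. \<phi> \<in> F \<Longrightarrow> openin Z (B \<phi>)"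
  shows "openin X (cylinder F B)"
proof -
  let ?P = "PiE \<Phi> (\<lambda>\<phi>. if \<phi> \<in> F then B \<phi> else topspace Z)"
  have "finite {\<phi> \<in> \<Phi>. (if \<phi> \<in> F then B \<phi> else topspace Z) \<noteq> topspace Z}"
    by (rule finite_subset[OF _ F(1)]) auto
  moreover have "\<forall>\<phi>\<in>\<Phi>. openin Z (if \<phi> \<in> F then B \<phi> else topspace Z)" using B by simp
  ultimately have "openin (product_topology (\<lambda>_. Z) \<Phi>) ?P"
    by (intro iffD2[OF openin_PiE_gen] disjI2 conjI)
  then have "openin X (topspace X \<inter> ?P)"
    unfolding topspace_X unfolding X_def by (rule openin_subtopology_Int2)
  moreover have "topspace X \<inter> ?P = cylinder F B"
  proof (intro equalityI subsetI)
    fix x assume x: "x \<in> topspace X \<inter> ?P"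
    have "x \<phi> \<in> B \<phi>" if "\<phi> \<in> F" for \<phi>
      using PiE_mem[OF IntD2[OF x], of \<phi>] that F(2) by auto
    then show "x \<in> cylinder F B" using x unfolding cylinder_def by simp
  next
    fix x assume x: "x \<in> cylinder F B"
    then have xX: "x \<in> topspace X" unfolding cylinder_def by simp
    have "x \<in> ?P"
    proof (rule PiE_I)
      fix \<phi> assume "\<phi> \<in> \<Phi>"
      then show "x \<phi> \<in> (if \<phi> \<in> F then B \<phi> else topspace Z)"
        using x PiE_mem[OF X_in_PiE[OF xX]] unfolding cylinder_def by simp
    next
      fix \<phi> assume "\<phi> \<notin> \<Phi>"
      then show "x \<phi> = undefined" by (rule PiE_arb[OF X_in_PiE[OF xX]])
    qed
    with xX show "x \<in> topspace X \<inter> ?P" by simp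
  qed
  ultimately show ?thesis by simp
qed

lemma open_contains_cylinder:
  assumes U: "openin X U" "x \<in> U"
  obtains F B where "finite F" "F \<subseteq> \<Phi>" "\<And>\<phi>. \<phi> \<in> F \<Longrightarrow> openin Z (B \<phi>)"
    "x \<in> cylinder F B" "cylinder F B \<subseteq> U"
proof -
  obtain V where V: "openin (product_topology (\<lambda>_. Z) \<Phi>) V" "U = V \<inter> (eval ` M \<union> step_points)"
    using U(1) unfolding X_def openin_subtopology by auto
  have "x \<in> V" using V(2) U(2) by simp
  from bspec[OF iffD1[OF openin_product_topology_alt V(1)] this] obtain B where B: "finite {\<phi> \<in> \<Phi>. B \<phi> \<noteq> topspace Z}" "\<forall>\<phi>\<in>\<Phi>. openin Z (B \<phi>)"
      "x \<in> PiE \<Phi> B" "PiE \<Phi> B \<subseteq> V"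
    by (elim exE conjE)
  let ?F = "{\<phi> \<in> \<Phi>. B \<phi> \<noteq> topspace Z}"
  have xX: "x \<in> topspace X" using U openin_subset by blast
  show thesis
  proof (rule that[of ?F B])
    show "x \<in> cylinder ?F B" using xX PiE_mem[OF B(3)] unfolding cylinder_def by simp
    show "cylinder ?F B \<subseteq> U"
    proof
      fix y assume y: "y \<in> cylinder ?F B"
      then have yX: "y \<in> topspace X" unfolding cylinder_def by simp
      have "y \<in> PiE \<Phi> B"
      proof (rule PiE_I)
        fix \<phi> assume "\<phi> \<in> \<Phi>"
        then show "y \<phi> \<in> B \<phi>"
          using y PiE_mem[OF X_in_PiE[OF yX]] unfolding cylinder_def by (cases "B \<phi> = topspace Z") auto
      next
        fix \<phi> assume "\<phi> \<notin> \<Phi>"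
        then show "y \<phi> = undefined" by (rule PiE_arb[OF X_in_PiE[OF yX]])
      qed
      then show "y \<in> U" using B(4) V(2) yX unfolding topspace_X by blast
    qed
  qed (use B in auto)
qed

text \<open>By independence the cylinder contains some \<open>eval m\<close>, so it is a nonempty
  open set.\<close>

lemma dense_meets_cylinder:
  assumes D: "X closure_of D = topspace X"
    and F: "finite F" "F \<subseteq> \<Phi>" "\<And>\<phi>. \<phi> \<in> F \<Longrightarrow> openin Z (B \<phi>)" "\<And>\<phi>. \<phi> \<in> F \<Longrightarrow> B \<phi> \<noteq> {}"
  shows "\<exists>x\<in>D. \<forall>\<phi>\<in>F. x \<phi> \<in> B \<phi>"
proof -
  obtain m where m: "m \<in> M" "\<forall>\<phi>\<in>F. \<phi> m \<in> B \<phi>"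
    by (rule bexE[OF independent_familyD[OF indep F]])
  then have "eval m \<in> cylinder F B"
    unfolding cylinder_def using eval_in_X[OF m(1)] eval_apply F(2) by auto
  moreover have "openin X (cylinder F B)" by (rule open_cylinder[OF F(1-3)])
  ultimately have "D \<inter> cylinder F B \<noteq> {}"
    using D unfolding dense_intersects_open by blast
  then show ?thesis unfolding cylinder_def by blast
qed

text \<open>A cylinder constrains finitely many coordinates, and a step function can take prescribed
  values at their distinct codes.\<close>

lemma step_points_dense: "X closure_of step_points = topspace X"
  unfolding dense_intersects_open
proof (intro allI impI)
  fix U assume U: "openin X U \<and> U \<noteq> {}"
  then obtain x where x: "x \<in> U" by blast
  obtain F B where F: "finite F" "F \<subseteq> \<Phi>" "\<And>\<phi>. \<phi> \<in> F \<Longrightarrow> openin Z (B \<phi>)" "x \<in> cylinder F B" "cylinder F B \<subseteq> U"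
    using open_contains_cylinder[OF conjunct1[OF U] x] by blast
  have inj: "inj_on code F" using code_inj F(2) inj_on_subset by blast
  have "\<exists>l\<in>codes W (topspace Z). \<forall>A\<in>code ` F. step z0 l A = x (inv_into F code A)"
  proof (rule step_interpolation)
    show "code ` F \<subseteq> Pow W" using code_in F(2) by blast
    have "x \<phi> \<in> topspace Z" if "\<phi> \<in> F" for \<phi>
      using F(3)[OF that] F(4) that openin_subset unfolding cylinder_def by blast
    then show "(\<lambda>A. x (inv_into F code A)) ` code ` F \<subseteq> topspace Z" using inj by auto
  qed (use F in simp)
  then obtain l where l: "l \<in> codes W (topspace Z)" "\<forall>A\<in>code ` F. step z0 l A = x (inv_into F code A)"
    by (rule bexE)
  have sp: "step_point l \<in> step_points" using l(1) unfolding step_points_def by blast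
  have "step_point l \<phi> = x \<phi>" if "\<phi> \<in> F" for \<phi>
    using l(2) inj that F(2) unfolding step_point_def by auto
  then have "step_point l \<in> cylinder F B"
    using F(4) sp unfolding cylinder_def topspace_X by auto
  then show "step_points \<inter> U \<noteq> {}" using sp F(5) by blast
qed

lemma continuous_step_point:
  assumes l: "l1 \<in> codes W (topspace Z)" "l2 \<in> codes W (topspace Z)" "P \<in> lists W" "N \<in> lists W"
  shows "continuous_map Z X (\<lambda>z. step_point (l1 @ (P, N, z) # l2))"
proof -
  have codes: "l1 @ (P, N, z) # l2 \<in> codes W (topspace Z)" if "z \<in> topspace Z" for z
    using l that unfolding append_Cons_in_codes by (intro conjI)
  then have step_points: "step_point (l1 @ (P, N, z) # l2) \<in> step_points" if "z \<in> topspace Z" for z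
    unfolding step_points_def using that by (intro imageI)
  have "continuous_map Z Z (\<lambda>z. step z0 (l1 @ (P, N, z) # l2) A)" for A
  proof -
    consider "\<forall>z. step z0 (l1 @ (P, N, z) # l2) A = z"
      | c where "\<forall>z. step z0 (l1 @ (P, N, z) # l2) A = c"
      using step_value_cases[of z0 l1 P N l2 A] by blast
    then show ?thesis
    proof cases
      case 1
      then show ?thesis by simp
    next
      case (2 c)
      then have "c \<in> topspace Z" using step_in[OF codes[OF z0] z0, of A] by simp
      with 2 show ?thesis by simp
    qed
  qed
  then have "continuous_map Z (product_topology (\<lambda>_. Z) \<Phi>) (\<lambda>z. step_point (l1 @ (P, N, z) # l2))"
    unfolding continuous_map_componentwise step_point_def by auto
  then show ?thesis
    unfolding X_def continuous_map_in_subtopology using step_points by auto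
qed

text \<open>Resetting one listed value to \<open>z0\<close> moves along a continuous image of
  \<open>Z\<close> and preserves \<open>f\<close>. Resetting all of them leads to the constant point
  \<open>z0\<close>; density of \<open>step_points\<close> then extends the equality to
  \<open>X\<close>.\<close>

lemma constant_on_X:
  assumes f: "continuous_map X euclideanreal f"
  shows "\<exists>c. \<forall>x\<in>topspace X. f x = c"
proof -
  let ?T = "topspace Z"
  let ?r = "map (\<lambda>(P, N, z). (P, N, z0))"
  have change: "f (step_point (l1 @ (P, N, z) # l2)) = f (step_point (l1 @ (P, N, z0) # l2))"
    if "l1 \<in> codes W ?T" "l2 \<in> codes W ?T" "P \<in> lists W" "N \<in> lists W" "z \<in> ?T" for l1 l2 P N z
    using Z_const[OF continuous_map_compose[OF continuous_step_point[OF that(1-4)] f] that(5) z0] by simp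
  \<comment> \<open>The prefix is arbitrary because the induction moves each entry into it once it
    is reset.\<close>
  have "f (step_point (l1 @ l2)) = f (step_point (l1 @ ?r l2))"
    if "l2 \<in> codes W ?T" "l1 \<in> codes W ?T" for l1 l2
    using that
  proof (induct l2 arbitrary: l1 rule: list.induct)
    case (Cons q l2)
    note IH = Cons(1) and prems = Cons(2,3)
    obtain P N z where q: "q = (P, N, z)" by (rule prod_cases3)
    have in_codes: "l2 \<in> codes W ?T" "P \<in> lists W" "N \<in> lists W" "z \<in> ?T"
      using prems(1) unfolding q Cons_in_lists_iff mem_Sigma_iff by blast+
    have "f (step_point (l1 @ q # l2)) = f (step_point ((l1 @ [(P, N, z0)]) @ l2))"
      using change[OF prems(2) in_codes] unfolding q by simp
    also have "\<dots> = f (step_point ((l1 @ [(P, N, z0)]) @ ?r l2))"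
      by (rule IH[OF in_codes(1)])
         (unfold append_Cons_in_codes, intro conjI prems(2) in_codes z0 lists.Nil)
    finally show ?case unfolding q by simp
  qed simp
  note reset = this[OF _ lists.Nil, unfolded append_Nil]
  have default: "step_point (?r l) = (\<lambda>\<phi>\<in>\<Phi>. z0)" for l
    unfolding step_point_def step_constant ..
  have c: "f x = f (\<lambda>\<phi>\<in>\<Phi>. z0)" if "x \<in> step_points" for x
  proof -
    obtain l where l: "x = step_point l" "l \<in> codes W ?T"
      using \<open>x \<in> step_points\<close> unfolding step_points_def by (rule imageE)
    show ?thesis unfolding l(1) using reset[OF l(2)] unfolding default .
  qed
  have "f x = f (\<lambda>\<phi>\<in>\<Phi>. z0)" if "x \<in> topspace X" for x
    using forall_in_closure_of_eq[of x X step_points euclideanreal f "\<lambda>_. f (\<lambda>\<phi>\<in>\<Phi>. z0)"]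
      that step_points_dense f c by simp
  then show ?thesis by blast
qed

section \<open>Cardinality and irresolvability of the space\<close>

lemma infinite_M: "infinite M"
  using WM W card_of_ordLeq_finite ordLess_imp_ordLeq by blast

text \<open>Were the trace of an open set on \<open>eval ` M\<close> small, some member of the family would be constant on it.\<close>

lemma card_open_X:
  assumes U: "openin X U" "U \<noteq> {}"
  shows "|M| \<le>o |U|"
proof -
  obtain x where x: "x \<in> U" using U(2) by blast
  obtain F B where F: "finite F" "F \<subseteq> \<Phi>" "\<And>\<phi>. \<phi> \<in> F \<Longrightarrow> openin Z (B \<phi>)" "x \<in> cylinder F B" "cylinder F B \<subseteq> U"
    using open_contains_cylinder[OF U(1) x] by blast
  have ne: "\<And>\<phi>. \<phi> \<in> F \<Longrightarrow> B \<phi> \<noteq> {}" using F(4) unfolding cylinder_def by blast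
  let ?I = "{m \<in> M. \<forall>\<phi>\<in>F. \<phi> m \<in> B \<phi>}"
  have "\<not> |?I| <o |M|"
  proof
    assume "|?I| <o |M|"
    then have "infinite {\<phi> \<in> \<Phi>. \<forall>m\<in>?I. \<phi> m = z0}" by (intro escape) auto
    then have "\<not> {\<phi> \<in> \<Phi>. \<forall>m\<in>?I. \<phi> m = z0} \<subseteq> F" using F(1) finite_subset by blast
    then obtain \<psi> where \<psi>: "\<psi> \<in> \<Phi>" "\<psi> \<notin> F" "\<forall>m\<in>?I. \<psi> m = z0" by blast
    \<comment> \<open>Since \<open>\<psi> \<notin> F\<close>, the condition
      \<open>\<psi> m \<noteq> z0\<close> can be added to those of the cylinder; independence then
      yields a point of \<open>?I\<close> where \<open>\<psi>\<close> is not
      \<open>z0\<close>.\<close>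
    let ?B = "B(\<psi> := topspace Z - {z0})"
    have "openin Z (topspace Z - {z0})"
      using Z_t1 z0 by (auto simp: t1_space_closedin_singleton intro: openin_diff)
    then have "\<And>\<phi>. \<phi> \<in> insert \<psi> F \<Longrightarrow> openin Z (?B \<phi>)" using F(3) by auto
    moreover have "\<And>\<phi>. \<phi> \<in> insert \<psi> F \<Longrightarrow> ?B \<phi> \<noteq> {}" using ne z1 z01 by auto
    moreover have "finite (insert \<psi> F)" "insert \<psi> F \<subseteq> \<Phi>" using F \<psi> by auto
    ultimately have "\<exists>m\<in>M. \<forall>\<phi>\<in>insert \<psi> F. \<phi> m \<in> ?B \<phi>"
      by (intro independent_familyD[OF indep])
    then obtain m where m: "m \<in> M" "\<forall>\<phi>\<in>insert \<psi> F. \<phi> m \<in> ?B \<phi>" by (rule bexE)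
    have "\<phi> m \<in> B \<phi>" if "\<phi> \<in> F" for \<phi> using bspec[OF m(2), of \<phi>] that \<psi>(2) by (auto split: if_splits)
    then have "\<psi> m = z0" using m(1) \<psi>(3) by blast
    moreover have "\<psi> m \<in> topspace Z - {z0}" using m(2) by simp
    ultimately show False by simp
  qed
  then have "|M| \<le>o |?I|" using not_ordLess_iff_ordLeq card_of_Well_order by blast
  also have "|?I| \<le>o |U|"
  proof -
    have "eval ` ?I \<subseteq> U"
    proof -
      have "eval ` ?I \<subseteq> cylinder F B"
        unfolding cylinder_def using eval_in_X eval_apply F(2) by auto
      then show ?thesis using F(5) by blast
    qed
    moreover have "inj_on eval ?I" using inj_eval by (rule inj_on_subset) auto
    ultimately show ?thesis by (intro iffD1[OF card_of_ordLeq] exI conjI)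
  qed
  finally show ?thesis .
qed

lemma card_step_points: "|step_points| \<le>o |W|"
  unfolding step_points_def
  by (intro card_of_image_ordLeq card_of_codes W Z_card card_of_mono1) simp

lemma card_topspace_X: "|topspace X| =o |M|"
proof -
  have M: "|M| \<le>o |M|" by (rule card_of_mono1) simp
  have "|topspace X| \<le>o |M|"
    unfolding topspace_X
    by (intro card_of_Un_ordLeq_infinite' infinite_M card_of_image_ordLeq M
        ordLeq_transitive[OF card_step_points ordLess_imp_ordLeq[OF WM]])
  moreover have "|M| \<le>o |topspace X|"
    using inj_eval eval_in_X by (intro iffD1[OF card_of_ordLeq] exI conjI) auto
  ultimately show ?thesis by (simp add: ordIso_iff_ordLeq)
qed

text \<open>
  At most \<open>|W|\<close> of the dense sets meet \<open>step_points\<close>. If \<open>|Z|\<close> of the others were pairwise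
  disjoint, a function taking a different value on each of them could be added to the family.
\<close>

lemma not_resolvable_X:
  assumes card: "|W| <o |\<D>|" and disj: "pairwise disjnt \<D>"
    and dense: "\<And>D. D \<in> \<D> \<Longrightarrow> D \<subseteq> topspace X \<and> X closure_of D = topspace X"
  shows False
proof -
  \<comment> \<open>The dense sets in \<open>?E\<close> consist of points \<open>eval m\<close>
    only. The others are counted by choosing a step point from each.\<close>
  let ?E = "{D \<in> \<D>. D \<inter> step_points = {}}"
  have "\<forall>D\<in>\<D> - ?E. \<exists>s. s \<in> D \<inter> step_points" by blast
  from bchoice[OF this] obtain s where s: "\<forall>D\<in>\<D> - ?E. s D \<in> D \<inter> step_points" ..
  have "inj_on s (\<D> - ?E)"
  proof (rule inj_onI)
    fix D D' assume D: "D \<in> \<D> - ?E" "D' \<in> \<D> - ?E" "s D = s D'"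
    have "s D \<in> D" using bspec[OF s D(1)] by simp
    moreover have "s D \<in> D'" using bspec[OF s D(2)] D(3) by simp
    ultimately have "\<not> disjnt D D'" unfolding disjnt_def by blast
    then show "D = D'" using disj D unfolding pairwise_def by blast
  qed
  moreover have "s ` (\<D> - ?E) \<subseteq> step_points" using s by blast
  ultimately have "|\<D> - ?E| \<le>o |step_points|" by (intro iffD1[OF card_of_ordLeq] exI conjI)
  then have rest: "|\<D> - ?E| \<le>o |W|" using card_step_points by (rule ordLeq_transitive)
  have "\<not> |?E| \<le>o |W|"
  proof
    assume "|?E| \<le>o |W|"
    then have "|?E \<union> (\<D> - ?E)| \<le>o |W|" using rest by (rule card_of_Un_ordLeq_infinite'[OF W])
    moreover have "?E \<union> (\<D> - ?E) = \<D>" by blast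
    ultimately have "|\<D>| \<le>o |W|" by simp
    with card show False using not_ordLess_ordLeq by blast
  qed
  moreover have "|W| <o |?E| \<or> |?E| \<le>o |W|"
    by (rule ordLess_or_ordLeq[OF card_of_Well_order card_of_Well_order])
  ultimately have "|W| <o |?E|" by argo
  then have "|W| \<le>o |?E|" by (rule ordLess_imp_ordLeq)
  with Z_card have "|topspace Z| \<le>o |?E|" by (rule ordLeq_transitive)
  then obtain \<delta> where \<delta>: "inj_on \<delta> (topspace Z)" "\<delta> ` topspace Z \<subseteq> ?E"
    using card_of_ordLeq[of "topspace Z" ?E] by auto
  have \<delta>_disj: "z = z'" if "z \<in> topspace Z" "z' \<in> topspace Z" "x \<in> \<delta> z" "x \<in> \<delta> z'" for x z z'
  proof -
    have "\<not> disjnt (\<delta> z) (\<delta> z')" using that unfolding disjnt_def by blast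
    moreover have "\<delta> z \<in> \<D>" "\<delta> z' \<in> \<D>" using \<delta>(2) that by auto
    ultimately have "\<delta> z = \<delta> z'" using disj unfolding pairwise_def by blast
    then show ?thesis using \<delta>(1) that unfolding inj_on_def by blast
  qed
  \<comment> \<open>The value is \<open>z\<close> on \<open>\<delta> z\<close>, and the default
    \<open>z0\<close> off all these sets.\<close>
  define \<phi> where "\<phi> = (\<lambda>m\<in>M. if \<exists>z\<in>topspace Z. eval m \<in> \<delta> z
                               then THE z. z \<in> topspace Z \<and> eval m \<in> \<delta> z else z0)"
  have \<phi>_val: "\<phi> m = z" if "m \<in> M" "z \<in> topspace Z" "eval m \<in> \<delta> z" for m z
  proof -
    have "(THE z. z \<in> topspace Z \<and> eval m \<in> \<delta> z) = z"
      using that \<delta>_disj by (intro the_equality) blast+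
    then show ?thesis unfolding \<phi>_def using that by auto
  qed
  have \<phi>_in: "\<phi> \<in> M \<rightarrow>\<^sub>E topspace Z"
  proof (rule PiE_I)
    fix m assume m: "m \<in> M"
    show "\<phi> m \<in> topspace Z"
    proof (cases "\<exists>z\<in>topspace Z. eval m \<in> \<delta> z")
      case True
      then show ?thesis using \<phi>_val[OF m] by blast
    qed (use m z0 in \<open>simp add: \<phi>_def\<close>)
  qed (simp add: \<phi>_def)
  have meets: "\<exists>m\<in>M. eval m \<in> \<delta> z \<and> (\<forall>\<psi>\<in>F. \<psi> m \<in> B \<psi>)"
    if z: "z \<in> topspace Z" and F: "finite F" "F \<subseteq> \<Phi>" "\<And>\<psi>. \<psi> \<in> F \<Longrightarrow> openin Z (B \<psi>)" "\<And>\<psi>. \<psi> \<in> F \<Longrightarrow> B \<psi> \<noteq> {}"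
    for z F B
  proof -
    have E: "\<delta> z \<in> ?E" using \<delta>(2) z by blast
    then have D: "\<delta> z \<subseteq> topspace X" "X closure_of \<delta> z = topspace X" using dense by auto
    obtain x where x: "x \<in> \<delta> z" "\<forall>\<psi>\<in>F. x \<psi> \<in> B \<psi>"
      using dense_meets_cylinder[OF D(2) F] by (rule bexE)
    then have "x \<in> eval ` M" using E D(1) unfolding topspace_X by blast
    then obtain m where m: "m \<in> M" "x = eval m" by blast
    then have "\<forall>\<psi>\<in>F. \<psi> m \<in> B \<psi>" using x(2) F(2) eval_apply by (metis subsetD)
    with m x(1) show ?thesis by blast
  qed
  have "independent_family Z M (insert \<phi> \<Phi>)"
    unfolding independent_family_def
  proof (intro conjI allI impI)
    show "insert \<phi> \<Phi> \<subseteq> M \<rightarrow>\<^sub>E topspace Z"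
      using \<phi>_in indep unfolding independent_family_def by simp
    fix F B assume F: "finite F" "F \<subseteq> insert \<phi> \<Phi>" "\<forall>\<psi>\<in>F. openin Z (B \<psi>) \<and> B \<psi> \<noteq> {}"
    \<comment> \<open>\<open>z\<close> is chosen to satisfy the condition on \<open>\<phi>\<close>,
      if there is one. The other conditions can be met inside the dense set
      \<open>\<delta> z\<close>, where \<open>\<phi>\<close> equals \<open>z\<close>.\<close>
    obtain z where z: "z \<in> topspace Z" "\<phi> \<in> F \<longrightarrow> z \<in> B \<phi>"
    proof (cases "\<phi> \<in> F")
      case True
      then obtain z where "z \<in> B \<phi>" using F(3) by blast
      moreover have "B \<phi> \<subseteq> topspace Z" using F(3) True openin_subset by blast
      ultimately show thesis by (intro that[of z]) auto
    qed (use that z0 in blast)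
    have "\<exists>m\<in>M. eval m \<in> \<delta> z \<and> (\<forall>\<psi>\<in>F - {\<phi>}. \<psi> m \<in> B \<psi>)"
      by (rule meets[OF z(1)]) (use F in auto)
    then obtain m where m: "m \<in> M" "eval m \<in> \<delta> z" "\<forall>\<psi>\<in>F - {\<phi>}. \<psi> m \<in> B \<psi>" by blast
    have "\<phi> m = z" by (rule \<phi>_val[OF m(1) z(1) m(2)])
    then have "\<forall>\<psi>\<in>F. \<psi> m \<in> B \<psi>" using m(3) z(2) by blast
    with m(1) show "\<exists>m\<in>M. \<forall>\<psi>\<in>F. \<psi> m \<in> B \<psi>" by (rule rev_bexI)
  qed
  then have "\<phi> \<in> \<Phi>" by (rule maximal)
  \<comment> \<open>Now that \<open>\<phi>\<close> belongs to the family, density of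
    \<open>\<delta> z0\<close> gives a point there with \<open>\<phi> m \<noteq> z0\<close>,
    although \<open>\<phi>\<close> is \<open>z0\<close> on that set.\<close>
  have "openin Z (topspace Z - {z0})"
    using Z_t1 z0 by (auto simp: t1_space_closedin_singleton intro: openin_diff)
  then have "\<exists>m\<in>M. eval m \<in> \<delta> z0 \<and> (\<forall>\<psi>\<in>{\<phi>}. \<psi> m \<in> topspace Z - {z0})"
    using \<open>\<phi> \<in> \<Phi>\<close> z1 z01 by (intro meets[OF z0]) auto
  then obtain m where "m \<in> M" "eval m \<in> \<delta> z0" "\<phi> m \<noteq> z0" by auto
  with \<phi>_val[OF _ z0] show False by blast
qed

end

section \<open>Power sets and transport along homeomorphisms\<close>

lemma card_of_Pow_mono_ordLeq:
  assumes "|A| \<le>o |B|" shows "|Pow A| \<le>o |Pow B|"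
proof -
  obtain f where f: "inj_on f A" "f ` A \<subseteq> B" using assms card_of_ordLeq[of A B] by auto
  have "(`) f ` Pow A \<subseteq> Pow B" using f(2) by blast
  with inj_on_image_Pow[OF f(1)] show ?thesis by (intro iffD1[OF card_of_ordLeq] exI conjI)
qed

lemma card_of_PiE_ordLeq_Pow: "|A \<rightarrow>\<^sub>E B| \<le>o |Pow (A \<times> B)|"
proof -
  let ?g = "\<lambda>f. {(x, f x) | x. x \<in> A}"
  have "inj_on ?g (A \<rightarrow>\<^sub>E B)"
  proof (rule inj_onI)
    fix f g assume f: "f \<in> A \<rightarrow>\<^sub>E B" and g: "g \<in> A \<rightarrow>\<^sub>E B" and eq: "?g f = ?g g"
    show "f = g"
    proof (rule PiE_ext[OF f g])
      fix x assume "x \<in> A"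
      then have "(x, f x) \<in> ?g f" by blast
      then show "f x = g x" unfolding eq by blast
    qed
  qed
  moreover have "?g ` (A \<rightarrow>\<^sub>E B) \<subseteq> Pow (A \<times> B)" by auto
  ultimately show ?thesis by (intro iffD1[OF card_of_ordLeq] exI conjI)
qed

text \<open>Pulling the topology back along the inverse of a bijection onto \<open>M\<close> moves a
  space of functions to the type of \<open>M\<close>.\<close>

lemma exists_homeomorphic_copy:
  assumes "|topspace X| =o |M|"
  obtains Y g h where "topspace Y = M" "homeomorphic_maps X Y g h"
proof -
  obtain g where g: "bij_betw g (topspace X) M" using assms card_of_ordIso[of "topspace X" M] by auto
  define h where "h = inv_into (topspace X) g"
  have h: "bij_betw h M (topspace X)" unfolding h_def by (rule bij_betw_inv_into[OF g])
  have hg: "h (g x) = x" if "x \<in> topspace X" for x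
    unfolding h_def by (rule bij_betw_inv_into_left[OF g that])
  have gh: "g (h y) = y" if "y \<in> M" for y
    unfolding h_def by (rule bij_betw_inv_into_right[OF g that])
  let ?Y = "pullback_topology M h X"
  have top: "topspace ?Y = M"
    unfolding topspace_pullback_topology using h by (auto simp: bij_betw_def)
  have "continuous_map X X (h \<circ> g)"
    by (rule continuous_map_eq[OF continuous_map_id]) (simp add: hg)
  moreover have "topspace X \<subseteq> g -` M" using g by (auto simp: bij_betw_def)
  ultimately have "continuous_map X ?Y g" by (rule continuous_map_pullback')
  moreover have "continuous_map ?Y X h"
    using continuous_map_pullback[OF continuous_map_id, of M h X] by simp
  ultimately have "homeomorphic_maps X ?Y g h"
    unfolding homeomorphic_maps_def top using hg gh by blast
  with top show thesis by (rule that)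
qed

lemma resolvable_space_homeomorphic:
  assumes gh: "homeomorphic_maps X Y g h" and Y: "resolvable_space \<nu> Y"
  shows "resolvable_space \<nu> X"
proof -
  obtain \<D> where \<D>: "|\<D>| =o \<nu>" "pairwise disjnt \<D>"
    "\<And>D. D \<in> \<D> \<Longrightarrow> D \<subseteq> topspace Y \<and> Y closure_of D = topspace Y"
    using Y unfolding resolvable_space_def by auto
  have h: "homeomorphic_map Y X h" using gh homeomorphic_maps_map homeomorphic_maps_sym by blast
  have inj: "inj_on h (topspace Y)" and onto: "h ` topspace Y = topspace X"
    using h homeomorphic_imp_injective_map homeomorphic_imp_surjective_map by blast+
  have "inj_on ((`) h) \<D>"
    by (rule inj_on_subset[OF inj_on_image_Pow[OF inj]]) (use \<D>(3) in blast)
  then have "bij_betw ((`) h) \<D> ((`) h ` \<D>)" by (rule inj_on_imp_bij_betw)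
  then have "|(`) h ` \<D>| =o |\<D>|" using card_of_ordIso[of \<D> "(`) h ` \<D>"] ordIso_symmetric by blast
  then have "|(`) h ` \<D>| =o \<nu>" using \<D>(1) by (rule ordIso_transitive)
  moreover have "pairwise disjnt ((`) h ` \<D>)"
  proof (rule pairwise_imageI)
    fix D D' assume D: "D \<in> \<D>" "D' \<in> \<D>" "D \<noteq> D'"
    then have "D \<inter> D' = {}" using \<D>(2) unfolding pairwise_def disjnt_def by blast
    moreover have "h ` (D \<inter> D') = h ` D \<inter> h ` D'"
      by (rule inj_on_image_Int[OF inj]) (use \<D>(3) D in blast)+
    ultimately show "disjnt (h ` D) (h ` D')" unfolding disjnt_def by simp
  qed
  moreover have "h ` D \<subseteq> topspace X \<and> X closure_of (h ` D) = topspace X" if "D \<in> \<D>" for D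
    using homeomorphic_map_closure_of[OF h conjunct1[OF \<D>(3)[OF that]]] \<D>(3)[OF that] onto by auto
  ultimately show ?thesis unfolding resolvable_space_def by blast
qed

theorem theorem5p5:
  fixes \<kappa> :: "'k rel" and \<mu> :: "'l rel"
  assumes "Card_order \<kappa>" and "Card_order \<mu>"
    and "cardSuc natLeq \<le>o \<kappa>" and "\<kappa> <o \<mu>"
    and "ctwo ^c \<kappa> =o ctwo ^c \<mu>"
  shows "\<exists>X :: 'l topology.
           irresolvable_space (cardSuc \<kappa>) X \<and>
           regular_space X \<and> t1_space X \<and>
           |topspace X| =o \<mu> \<and> dispersion_character X =o \<mu> \<and>
           (\<forall>f. continuous_map X euclideanreal f \<longrightarrow>
                (\<exists>c. \<forall>x\<in>topspace X. f x = c))"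
proof -
  let ?W = "Field \<kappa>" and ?M = "Field \<mu>"
  have W\<kappa>: "|?W| =o \<kappa>" and M\<mu>: "|?M| =o \<mu>" using assms(1,2) by (auto intro: card_of_Field_ordIso)
  have W: "uncountable ?W"
  proof
    assume "countable ?W"
    then obtain f :: "'k \<Rightarrow> nat" where "inj_on f ?W" unfolding countable_def by blast
    then have "|?W| \<le>o |UNIV :: nat set|" using card_of_ordLeq[of ?W "UNIV :: nat set"] by blast
    then have "\<kappa> \<le>o |UNIV :: nat set|" by (rule ordIso_ordLeq_trans[OF ordIso_symmetric[OF W\<kappa>]])
    then have "\<kappa> \<le>o natLeq" using card_of_nat by (rule ordLeq_ordIso_trans)
    also have "natLeq <o cardSuc natLeq" by (rule cardSuc_greater[OF natLeq_Card_order])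
    also have "cardSuc natLeq \<le>o \<kappa>" by (rule assms(3))
    finally show False using not_ordLess_ordLeq[of \<kappa> \<kappa>] ordLess_imp_ordLeq by blast
  qed
  then have infW: "infinite ?W" using countable_finite by blast
  have WM: "|?W| <o |?M|"
    using ordIso_ordLess_trans[OF W\<kappa> assms(4)] ordIso_symmetric[OF M\<mu>] by (rule ordLess_ordIso_trans)
  then have infM: "infinite ?M"
    using infW card_of_ordLeq_finite ordLess_imp_ordLeq by blast
  have Pow: "|Pow (Field r)| =o ctwo ^c r" for r :: "'x rel"
    unfolding ctwo_def cexp_def Field_card_of by (rule card_of_Pow_Func)
  \<comment> \<open>The equality of the two powers enters here; it will embed the family, which has
    at most \<open>|Pow ?M|\<close> members, into \<open>Pow ?W\<close>.\<close>
  have PowM: "|Pow ?M| \<le>o |Pow ?W|"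
    by (rule ordIso_imp_ordLeq[OF ordIso_transitive[OF Pow ordIso_symmetric[OF ordIso_transitive[OF Pow assms(5)]]]])
  obtain Z :: "(nat \<Rightarrow> 'k ladder) topology" and z0 z1 where Z:
    "regular_space Z" "t1_space Z" "|topspace Z| \<le>o |?W|" "z0 \<in> topspace Z" "z1 \<in> topspace Z" "z0 \<noteq> z1"
    "\<And>f x y. continuous_map Z euclideanreal f \<Longrightarrow> x \<in> topspace Z \<Longrightarrow> y \<in> topspace Z \<Longrightarrow> f x = f y"
    by (rule exists_regular_space_constant_maps[OF W]) (rule that)
  have ZM: "|topspace Z| \<le>o |?M|" using Z(3) ordLess_imp_ordLeq[OF WM] by (rule ordLeq_transitive)
  obtain \<Phi>0 where \<Phi>0: "independent_family Z ?M \<Phi>0"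
    "\<And>I. I \<subseteq> ?M \<Longrightarrow> |I| <o |?M| \<Longrightarrow> infinite {\<phi> \<in> \<Phi>0. \<forall>m\<in>I. \<phi> m = z0}"
    "\<And>m m'. m \<in> ?M \<Longrightarrow> m' \<in> ?M \<Longrightarrow> m \<noteq> m' \<Longrightarrow> \<exists>\<phi>\<in>\<Phi>0. \<phi> m \<noteq> \<phi> m'"
    by (rule exists_independent_family[OF infM ZM Z(4-6)]) (rule that)
  obtain \<Phi> where \<Phi>: "\<Phi>0 \<subseteq> \<Phi>" "independent_family Z ?M \<Phi>"
    "\<And>\<phi>. independent_family Z ?M (insert \<phi> \<Phi>) \<Longrightarrow> \<phi> \<in> \<Phi>"
    by (rule maximal_independent[OF \<Phi>0(1)]) (rule that)
  have "|\<Phi>| \<le>o |?M \<rightarrow>\<^sub>E topspace Z|"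
    using \<Phi>(2) unfolding independent_family_def by (intro card_of_mono1) simp
  also have "|?M \<rightarrow>\<^sub>E topspace Z| \<le>o |Pow (?M \<times> topspace Z)|" by (rule card_of_PiE_ordLeq_Pow)
  also have "|Pow (?M \<times> topspace Z)| \<le>o |Pow ?M|"
    by (intro card_of_Pow_mono_ordLeq card_of_Times_ordLeq_infinite infM ZM card_of_mono1 subset_refl)
  also have "|Pow ?M| \<le>o |Pow ?W|" by (rule PowM)
  finally obtain code where code: "inj_on code \<Phi>" "code ` \<Phi> \<subseteq> Pow ?W"
    using card_of_ordLeq[of \<Phi> "Pow ?W"] by auto
  interpret generic_family Z ?M ?W \<Phi> z0 z1 code
  proof
    \<comment> \<open>This property and the next only ask for members of the family, so they pass
      from \<open>\<Phi>0\<close> to the larger \<open>\<Phi>\<close>.\<close>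
    show "infinite {\<phi> \<in> \<Phi>. \<forall>m\<in>I. \<phi> m = z0}" if "I \<subseteq> ?M" "|I| <o |?M|" for I
      using \<Phi>0(2)[OF that] by (rule infinite_super[rotated]) (use \<Phi>(1) in blast)
    show "\<exists>\<phi>\<in>\<Phi>. \<phi> m \<noteq> \<phi> m'" if "m \<in> ?M" "m' \<in> ?M" "m \<noteq> m'" for m m'
      using \<Phi>0(3)[OF that] \<Phi>(1) by blast
  qed (fact Z infW WM \<Phi>(2,3) code)+
  obtain Y :: "'l topology" and g h where Y: "topspace Y = ?M" and gh: "homeomorphic_maps X Y g h"
    by (rule exists_homeomorphic_copy[OF card_topspace_X]) (rule that)
  have hom: "X homeomorphic_space Y" using gh unfolding homeomorphic_space_def by blast
  have g: "homeomorphic_map X Y g" and h: "homeomorphic_map Y X h"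
    using gh homeomorphic_maps_map homeomorphic_maps_sym by blast+
  have YM: "|topspace Y| \<le>o |V|" if V: "openin Y V" "V \<noteq> {}" for V
  proof -
    have "openin X (h ` V)"
      using homeomorphic_map_openness_eq[OF h, of V] V(1) by blast
    then have "|?M| \<le>o |h ` V|" using V(2) by (intro card_open_X) auto
    then show ?thesis unfolding Y using card_of_image by (rule ordLeq_transitive)
  qed
  have neY: "topspace Y \<noteq> {}" unfolding Y using infM by auto
  have "dispersion_character Y =o |topspace Y|"
    by (rule dispersion_character_unique[OF openin_topspace neY YM])
  then have disp: "dispersion_character Y =o \<mu>" using M\<mu> unfolding Y by (rule ordIso_transitive)
  have "\<not> resolvable_space (cardSuc \<kappa>) X"
  proof
    assume "resolvable_space (cardSuc \<kappa>) X"
    then obtain \<D> where \<D>: "|\<D>| =o cardSuc \<kappa>" "pairwise disjnt \<D>"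
      "\<And>D. D \<in> \<D> \<Longrightarrow> D \<subseteq> topspace X \<and> X closure_of D = topspace X"
      unfolding resolvable_space_def by auto
    have "|?W| <o |\<D>|"
      using ordIso_ordLess_trans[OF W\<kappa> cardSuc_greater[OF assms(1)]] ordIso_symmetric[OF \<D>(1)]
      by (rule ordLess_ordIso_trans)
    then show False using \<D>(2,3) by (rule not_resolvable_X)
  qed
  then have "\<not> resolvable_space (cardSuc \<kappa>) Y" using resolvable_space_homeomorphic[OF gh] by blast
  moreover have "cardSuc \<kappa> \<le>o dispersion_character Y"
    using cardSuc_least[OF assms(1,2,4)] ordIso_symmetric[OF disp] by (rule ordLeq_ordIso_trans)
  ultimately have "irresolvable_space (cardSuc \<kappa>) Y" unfolding irresolvable_space_def by blast
  moreover have "regular_space Y" "t1_space Y"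
    using regular_X t1_X homeomorphic_regular_space[OF hom] homeomorphic_t1_space[OF hom] by blast+
  moreover have "|topspace Y| =o \<mu>" unfolding Y by (rule M\<mu>)
  moreover have "\<exists>c. \<forall>y\<in>topspace Y. f y = c" if f: "continuous_map Y euclideanreal f" for f
  proof -
    have "continuous_map X euclideanreal (f \<circ> g)"
      by (rule continuous_map_compose[OF homeomorphic_imp_continuous_map[OF g] f])
    then obtain c where "\<forall>x\<in>topspace X. (f \<circ> g) x = c" using constant_on_X by blast
    then have "\<forall>y\<in>topspace Y. f y = c"
      unfolding homeomorphic_imp_surjective_map[OF g, symmetric] by simp
    then show ?thesis by blast
  qed
  ultimately show ?thesis using disp by blast
qed

end
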